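(* For every nonnegative integer $h$ there exists a graph $G$ with obstacle number ${\rm obs}(G)$ exactly $h$.
   Context: An obstacle representation of a graph $G$ consists of a set $P$ of points in the plane, one for each vertex of $G$, together with a set of closed polygonal obstacles (connected polygonal regions) such that the points of $P$ and the vertices of the obstacles are in general position (no three on a line), and such that two vertices of $G$ are adjacent if and only if the segment connecting the corresponding points does not meet any obstacle. The obstacle number ${\rm obs}(G)$ is the minimum number of obstacles in an obstacle representation of $G$. *)

theory Defs
  imports "HOL-Analysis.Analysis" "HOL-Library.Extended_Nat" "Graph_Theory.Pair_Digraph"
begin

text \<open>
  Graphs are finite, simple and undirected, i.e. instances of the locale \<open>pair_graph\<close>: both
  \<open>(u, v)\<close> and \<open>(v, u)\<close> belong to \<open>parcs G\<close> when \<open>u\<close> and \<open>v\<close> are adjacent.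
\<close>

definition polygonal_region :: "(real^2) set \<Rightarrow> bool" where
  "polygonal_region S \<longleftrightarrow>
     (\<exists>\<T>. finite \<T> \<and> \<T> \<noteq> {} \<and> (\<forall>T\<in>\<T>. 2 simplex T) \<and> S = \<Union>\<T>)"

definition polygonal_obstacle :: "(real^2) set \<Rightarrow> bool" where
  "polygonal_obstacle S \<longleftrightarrow> polygonal_region S \<and> connected S"

text \<open>
  The vertices of a polygonal region are the points of its boundary near which the boundary is
  not a straight line. They do not depend on the decomposition into triangles, and those on the
  boundary of a hole are included.
\<close>

definition region_vertices :: "(real^2) set \<Rightarrow> (real^2) set" where
  "region_vertices S = {v \<in> frontier S.
     \<not> (\<exists>e>0. \<exists>w. w \<noteq> v \<and> frontier S \<inter> ball v e = affine hull {v, w} \<inter> ball v e)}"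

definition general_position :: "(real^2) set \<Rightarrow> bool" where
  "general_position X \<longleftrightarrow>
     (\<forall>x\<in>X. \<forall>y\<in>X. \<forall>z\<in>X. x \<noteq> y \<and> y \<noteq> z \<and> x \<noteq> z \<longrightarrow> \<not> collinear {x, y, z})"

definition obstacle_representation ::
    "'a pair_pre_digraph \<Rightarrow> ('a \<Rightarrow> real^2) \<Rightarrow> (real^2) set set \<Rightarrow> bool" where
  "obstacle_representation G p \<O> \<longleftrightarrow>
     inj_on p (pverts G) \<and>
     finite \<O> \<and> (\<forall>S\<in>\<O>. polygonal_obstacle S) \<and>
     general_position (p ` pverts G \<union> (\<Union>S\<in>\<O>. region_vertices S)) \<and>
     (\<forall>u\<in>pverts G. \<forall>v\<in>pverts G. u \<noteq> v \<longrightarrow>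
        ((u, v) \<in> parcs G \<longleftrightarrow> (\<forall>S\<in>\<O>. closed_segment (p u) (p v) \<inter> S = {})))"

text \<open>The value is \<open>\<infinity>\<close> for a graph without any obstacle representation.\<close>

definition obs :: "'a pair_pre_digraph \<Rightarrow> enat" where
  "obs G = (INF \<O> \<in> {\<O>. \<exists>p. obstacle_representation G p \<O>}. enat (card \<O>))"

end

theory Submission
  imports Defs
begin

text \<open>
  If \<open>u\<close>, \<open>v\<close> are non-adjacent and have common neighbours \<open>a\<close>, \<open>b\<close> on different sides of the line
  \<open>uv\<close>, then an obstacle meeting the segment \<open>uv\<close> cannot leave the quadrilateral \<open>uavb\<close>. There is a
  graph on 11 vertices having such a trapped quadruple in every placement. In every placement of its
  lexicographic power of exponent \<open>2h\<close> a sweep finds \<open>h\<close> trapped quadruples with disjoint convex hulls, so the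
  obstacle number of this power is at least \<open>h\<close>.

  Deleting an edge increases the obstacle number by at most one, since the edge can be blocked by a
  small generic triangle. Starting with a complete graph, whose obstacle number is 0, and deleting
  edges until the lexicographic power is reached, the obstacle number therefore takes the value \<open>h\<close>.
\<close>

section \<open>Orientation and confinement\<close>

text \<open>A trapped quadruple forces a whole obstacle into its convex hull, and non-empty sets
  inside disjoint hulls are distinct; hence the sweep has to deliver disjoint hulls, not merely many
  quadruples. The lexicographic power serves this because every choice of one vertex from each
  outermost block induces the base graph again, wherever the placement puts these vertices. Each
  sweep step spends two digits, one for a block and one for a sub-block, so \<open>h\<close> steps
  use exponent \<open>2 * h\<close>. The number 11 is 9 + 2: three cycle edges with one more vertex
  in each of the three gaps between them, so that any two of these edges are at distance two, and
  two vertices spanning a line that is sent to infinity. In the deletion step, the corners of the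
  new triangle have to be generic with respect to the vertices of all obstacles already present.
  Those vertices are defined by the local shape of the boundary, so their finiteness has to be
  derived from half-plane descriptions of the triangles.\<close>

definition orient :: "real^2 \<Rightarrow> real^2 \<Rightarrow> real^2 \<Rightarrow> real" where
  "orient a b c = (b$1 - a$1) * (c$2 - a$2) - (b$2 - a$2) * (c$1 - a$1)"

lemma vec2_eq_iff: "x = y \<longleftrightarrow> x$1 = y$1 \<and> x$2 = y$2" for x y :: "'a^2"
  by (simp add: vec_eq_iff forall_2)

lemma orient_rotate: "orient b c a = orient a b c"
  by (simp add: orient_def algebra_simps)

lemma orient_swap: "orient b a c = - orient a b c"
  by (simp add: orient_def algebra_simps)

lemma orient_self [simp]: "orient a a b = 0" "orient a b a = 0" "orient a b b = 0"
  by (simp_all add: orient_def)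

lemma collinear_iff_orient: "collinear {a, b, c} \<longleftrightarrow> orient a b c = 0"
proof -
  have "collinear {b, a, c} \<longleftrightarrow> collinear {0, b - a, c - a}"
    by (rule collinear_3) (simp add: NO_MATCH_def)
  then have "collinear {a, b, c} \<longleftrightarrow> b = a \<or> c = a \<or> (\<exists>k. c - a = k *\<^sub>R (b - a))"
    by (simp add: insert_commute collinear_lemma)
  also have "\<dots> \<longleftrightarrow> orient a b c = 0"
  proof
    assume "b = a \<or> c = a \<or> (\<exists>k. c - a = k *\<^sub>R (b - a))"
    then show "orient a b c = 0"
      by (auto simp: orient_def vec2_eq_iff)
  next
    assume o: "orient a b c = 0"
    consider "b = a" | "b$1 \<noteq> a$1" | "b$2 \<noteq> a$2" by (auto simp: vec2_eq_iff)
    then show "b = a \<or> c = a \<or> (\<exists>k. c - a = k *\<^sub>R (b - a))"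
    proof cases
      case 2
      then have "c - a = ((c$1 - a$1) / (b$1 - a$1)) *\<^sub>R (b - a)"
        using o by (simp add: vec2_eq_iff orient_def eq_divide_eq mult.commute)
      then show ?thesis by blast
    next
      case 3
      then have "c - a = ((c$2 - a$2) / (b$2 - a$2)) *\<^sub>R (b - a)"
        using o by (simp add: vec2_eq_iff orient_def eq_divide_eq mult.commute)
      then show ?thesis by blast
    qed simp
  qed
  finally show ?thesis .
qed

text \<open>Cramer's rule without denominators: \<open>orient\<close> is twice a signed area, and
  the three areas spanned by \<open>z\<close> and the sides are its unnormalised barycentric
  coordinates.\<close>

lemma orient_barycentric:
  "orient u v a *\<^sub>R z = orient v a z *\<^sub>R u + orient a u z *\<^sub>R v + orient u v z *\<^sub>R a"
  by (simp add: vec2_eq_iff orient_def algebra_simps)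

lemma orient_barycentric_sum: "orient v a z + orient a u z + orient u v z = orient u v a"
  by (simp add: orient_def algebra_simps)

lemma orient_affine:
  assumes "s + t = 1"
  shows "orient a b (s *\<^sub>R x + t *\<^sub>R y) = s * orient a b x + t * orient a b y"
proof -
  have s: "s = 1 - t" using assms by simp
  show ?thesis unfolding s by (simp add: orient_def algebra_simps)
qed

lemma continuous_on_orient [continuous_intros]: "continuous_on S (orient a b)"
  unfolding orient_def[abs_def] by (intro continuous_intros)

lemma triangle_iff:
  assumes "orient u v a > 0"
  shows "z \<in> convex hull {u, v, a} \<longleftrightarrow> orient v a z \<ge> 0 \<and> orient a u z \<ge> 0 \<and> orient u v z \<ge> 0"
proof
  assume "z \<in> convex hull {u, v, a}"
  then obtain r s t where *: "z = r *\<^sub>R u + s *\<^sub>R v + t *\<^sub>R a" "r \<ge> 0" "s \<ge> 0" "t \<ge> 0" "r + s + t = 1"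
    unfolding convex_hull_3 by auto
  have r: "r = 1 - s - t" using * by simp
  have "orient v a z = r * orient u v a" "orient a u z = s * orient u v a" "orient u v z = t * orient u v a"
    unfolding *(1) r by (simp_all add: orient_def algebra_simps)
  then show "orient v a z \<ge> 0 \<and> orient a u z \<ge> 0 \<and> orient u v z \<ge> 0"
    using * assms by simp
next
  let ?D = "orient u v a"
  assume *: "orient v a z \<ge> 0 \<and> orient a u z \<ge> 0 \<and> orient u v z \<ge> 0"
  have "z = (1 / ?D) *\<^sub>R (?D *\<^sub>R z)" using assms by simp
  also have "\<dots> = (orient v a z / ?D) *\<^sub>R u + (orient a u z / ?D) *\<^sub>R v + (orient u v z / ?D) *\<^sub>R a"
    by (subst orient_barycentric) (simp add: scaleR_add_right divide_inverse mult.commute)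
  finally have "z = \<dots>" .
  moreover have "orient v a z / ?D + orient a u z / ?D + orient u v z / ?D = 1"
    using orient_barycentric_sum[of v a z u] assms by (simp add: add_divide_distrib[symmetric])
  ultimately show "z \<in> convex hull {u, v, a}"
    unfolding convex_hull_3 using * assms by (blast intro: divide_nonneg_pos)
qed

lemma triangle_side:
  assumes "orient u v a > 0" "z \<in> convex hull {u, v, a}" "orient u v z = 0"
  shows "z \<in> closed_segment u v"
proof -
  obtain r s t where *: "z = r *\<^sub>R u + s *\<^sub>R v + t *\<^sub>R a" "r \<ge> 0" "s \<ge> 0" "t \<ge> 0" "r + s + t = 1"
    using assms(2) unfolding convex_hull_3 by auto
  have r: "r = 1 - s - t" using * by simp
  have "orient u v z = t * orient u v a"
    unfolding *(1) r by (simp add: orient_def algebra_simps)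
  then have "t = 0" using assms by simp
  then show ?thesis using * by (auto simp: in_segment intro!: exI[of _ s])
qed

text \<open>\<open>S\<close> misses the four sides, so inside the two closed triangles over the
  diagonal \<open>u v\<close> it stays in the open set \<open>W\<close>. Thus \<open>W\<close> and
  the open complement of the triangles cover \<open>S\<close>, and connectedness leaves only the
  piece containing \<open>z\<close>.\<close>

lemma connected_confined_by_quadrilateral:
  assumes a: "orient u v a > 0" and b: "orient u v b < 0" and S: "connected S"
    and z: "z \<in> S" "z \<in> closed_segment u v"
    and avoid: "closed_segment u a \<inter> S = {}" "closed_segment v a \<inter> S = {}"
      "closed_segment u b \<inter> S = {}" "closed_segment v b \<inter> S = {}"
  shows "S \<subseteq> convex hull {u, v, a, b}"
proof -
  \<comment> \<open>The open quadrilateral, which need not be convex: two open triangles, and the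
    intersection of the open wedges at \<open>a\<close> and \<open>b\<close>. The latter contains
    the open diagonal and keeps the union open there.\<close>
  define W where "W = {x. orient u v x > 0 \<and> orient v a x > 0 \<and> orient a u x > 0}
    \<union> {x. orient u v x < 0 \<and> orient u b x > 0 \<and> orient b v x > 0}
    \<union> {x. orient v a x > 0 \<and> orient a u x > 0 \<and> orient u b x > 0 \<and> orient b v x > 0}"
  let ?T1 = "convex hull {u, v, a}" and ?T2 = "convex hull {v, u, b}"
  have b': "orient v u b > 0" using b by (simp add: orient_swap[of v])
  have T1: "x \<in> ?T1 \<longleftrightarrow> orient v a x \<ge> 0 \<and> orient a u x \<ge> 0 \<and> orient u v x \<ge> 0" for x
    by (rule triangle_iff[OF a])
  have T2: "x \<in> ?T2 \<longleftrightarrow> orient u b x \<ge> 0 \<and> orient b v x \<ge> 0 \<and> orient u v x \<le> 0" for x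
    using triangle_iff[OF b', of x] orient_swap[of v u x] by simp
  have "open W"
    unfolding W_def
    by (intro open_Un open_Collect_conj open_Collect_less continuous_intros)
  have "W \<subseteq> ?T1 \<union> ?T2"
  proof
    fix x assume "x \<in> W"
    then show "x \<in> ?T1 \<union> ?T2"
      unfolding W_def Un_iff T1 T2 by (cases "orient u v x \<ge> 0") auto
  qed
  have base: "x \<in> W" if "x \<in> closed_segment u v" "x \<noteq> u" "x \<noteq> v" for x
  proof -
    obtain t where t: "x = (1 - t) *\<^sub>R u + t *\<^sub>R v" "0 \<le> t" "t \<le> 1"
      using \<open>x \<in> closed_segment u v\<close> by (auto simp: in_segment)
    have "t \<noteq> 0" "t \<noteq> 1" using t that by auto
    then have "0 < t" "t < 1" using t by auto
    moreover have "orient v a x = (1 - t) * orient u v a" "orient a u x = t * orient u v a"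
      "orient u b x = t * orient v u b" "orient b v x = (1 - t) * orient v u b"
      unfolding t(1) by (simp_all add: orient_def algebra_simps)
    ultimately show "x \<in> W" using a b' unfolding W_def by simp
  qed
  have "S \<inter> (?T1 \<union> ?T2) \<subseteq> W"
  proof
    fix x assume x: "x \<in> S \<inter> (?T1 \<union> ?T2)"
    have ne: "x \<noteq> u" "x \<noteq> v" using x avoid by auto
    have sides: "x \<notin> closed_segment v a" "x \<notin> closed_segment a u" "x \<notin> closed_segment u b"
      "x \<notin> closed_segment b v"
      using x avoid by (auto simp: closed_segment_commute)
    show "x \<in> W"
    proof (cases "x \<in> closed_segment u v")
      case True
      then show ?thesis using base ne by blast
    next
      case False
      show ?thesis
      proof (cases "x \<in> ?T1")
        case True
        have "orient u v x \<noteq> 0" using triangle_side[OF a True] False by blast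
        moreover have "orient v a x \<noteq> 0"
          using triangle_side[of v a u x] sides True a orient_rotate[of v a u] by (auto simp: insert_commute)
        moreover have "orient a u x \<noteq> 0"
          using triangle_side[of a u v x] sides True a orient_rotate[of a u v] orient_rotate[of u v a]
          by (auto simp: insert_commute)
        ultimately show ?thesis using True unfolding T1 W_def by auto
      next
        case F: False
        then have T: "x \<in> ?T2" using x by blast
        have "orient v u x \<noteq> 0" using triangle_side[OF b' T] False by (auto simp: closed_segment_commute)
        moreover have "orient u b x \<noteq> 0"
          using triangle_side[of u b v x] sides T b' orient_rotate[of u b v] by (auto simp: insert_commute)
        moreover have "orient b v x \<noteq> 0"
          using triangle_side[of b v u x] sides T b' orient_rotate[of b v u] orient_rotate[of v u b]
          by (auto simp: insert_commute)
        ultimately show ?thesis using T orient_swap[of v u x] unfolding T2 W_def by auto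
      qed
    qed
  qed
  moreover have "z \<in> W" using base z avoid by auto
  moreover have "open (- (?T1 \<union> ?T2))"
    by (intro open_Compl closed_Un compact_imp_closed compact_convex_hull) auto
  ultimately have "S \<subseteq> W"
    using connectedD[OF S \<open>open W\<close>, of "- (?T1 \<union> ?T2)"] \<open>W \<subseteq> ?T1 \<union> ?T2\<close> z by blast
  also have "W \<subseteq> ?T1 \<union> ?T2" by fact
  also have "\<dots> \<subseteq> convex hull {u, v, a, b}"
    by (intro Un_least hull_mono) auto
  finally show ?thesis .
qed

section \<open>A graph with a trapped quadruple in every placement\<close>

text \<open>Points have abscissa \<open>t\<close> and height \<open>w\<close>; the outer factor
  makes each inequality say "above the line" for either order of the two abscissae. If
  \<open>r\<close> were between \<open>u\<close> and \<open>v\<close>, the point of the segment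
  \<open>u v\<close> at abscissa \<open>tr\<close> would average two points above the line
  \<open>r s\<close>, so it would be above \<open>r\<close>, which is itself above
  \<open>u v\<close>.\<close>

lemma not_between_if_above:
  fixes tu :: real
  assumes uv: "tu < tv" and rs: "tr \<noteq> ts"
    and r: "(tv - tu) * ((tv - tu) * (wr - wu) - (tr - tu) * (wv - wu)) > 0"
    and u: "(ts - tr) * ((ts - tr) * (wu - wr) - (tu - tr) * (ws - wr)) > 0"
    and v: "(ts - tr) * ((ts - tr) * (wv - wr) - (tv - tr) * (ws - wr)) > 0"
  shows "tr < tu \<or> tv < tr"
proof (rule ccontr)
  assume "\<not> ?thesis"
  then have tr: "tu \<le> tr" "tr \<le> tv" by auto
  define m where "m = (ws - wr) / (ts - tr)"
  have m: "ws - wr = m * (ts - tr)" using rs by (simp add: m_def)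
  have pos: "(ts - tr)\<^sup>2 > 0" using rs by simp
  have "(ts - tr) * ((ts - tr) * (wu - wr) - (tu - tr) * (ws - wr))
      = (ts - tr)\<^sup>2 * ((wu - wr) - m * (tu - tr))"
    unfolding m by algebra
  with u have "(ts - tr)\<^sup>2 * ((wu - wr) - m * (tu - tr)) > 0" by metis
  then have u': "(wu - wr) - m * (tu - tr) > 0" using pos zero_less_mult_pos by blast
  have "(ts - tr) * ((ts - tr) * (wv - wr) - (tv - tr) * (ws - wr))
      = (ts - tr)\<^sup>2 * ((wv - wr) - m * (tv - tr))"
    unfolding m by algebra
  with v have "(ts - tr)\<^sup>2 * ((wv - wr) - m * (tv - tr)) > 0" by metis
  then have v': "(wv - wr) - m * (tv - tr) > 0" using pos zero_less_mult_pos by blast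
  have "(tv - tr) * ((wu - wr) - m * (tu - tr)) + (tr - tu) * ((wv - wr) - m * (tv - tr)) \<ge> 0"
    using tr u' v' by simp
  moreover have "(tv - tu) * (wr - wu) - (tr - tu) * (wv - wu) > 0"
    using r uv zero_less_mult_pos[of "tv - tu"] by (metis diff_gt_0_iff_gt)
  moreover have "(tv - tr) * ((wu - wr) - m * (tu - tr)) + (tr - tu) * ((wv - wr) - m * (tv - tr))
      = - ((tv - tu) * (wr - wu) - (tr - tu) * (wv - wu))" by algebra
  ultimately show False by linarith
qed

text \<open>
  If \<open>r\<close> and \<open>s\<close> lie above the line \<open>uv\<close>, and \<open>u\<close> and \<open>v\<close> above the line \<open>rs\<close>, then no vertical
  line meets both segments, as each of the two intersection points would be above the other.
\<close>

lemma separated_if_mutually_above: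
  fixes tu :: real
  assumes "tu \<noteq> tv" "tr \<noteq> ts"
    and r: "(tv - tu) * ((tv - tu) * (wr - wu) - (tr - tu) * (wv - wu)) > 0"
    and s: "(tv - tu) * ((tv - tu) * (ws - wu) - (ts - tu) * (wv - wu)) > 0"
    and u: "(ts - tr) * ((ts - tr) * (wu - wr) - (tu - tr) * (ws - wr)) > 0"
    and v: "(ts - tr) * ((ts - tr) * (wv - wr) - (tv - tr) * (ws - wr)) > 0"
  shows "(tu < tr \<and> tu < ts \<and> tv < tr \<and> tv < ts) \<or> (tr < tu \<and> ts < tu \<and> tr < tv \<and> ts < tv)"
proof -
  have r': "(tu - tv) * ((tu - tv) * (wr - wv) - (tr - tv) * (wu - wv)) > 0"
    using r by argo
  have s': "(tu - tv) * ((tu - tv) * (ws - wv) - (ts - tv) * (wu - wv)) > 0"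
    using s by argo
  have u': "(tr - ts) * ((tr - ts) * (wu - ws) - (tu - ts) * (wr - ws)) > 0"
    using u by argo
  have v': "(tr - ts) * ((tr - ts) * (wv - ws) - (tv - ts) * (wr - ws)) > 0"
    using v by argo
  have "tr < min tu tv \<or> max tu tv < tr"
    using not_between_if_above[OF _ assms(2) r u v] not_between_if_above[OF _ assms(2) r' v u] assms(1)
    by (cases "tu < tv") auto
  moreover have "ts < min tu tv \<or> max tu tv < ts"
    using not_between_if_above[OF _ assms(2)[symmetric] s u' v']
      not_between_if_above[OF _ assms(2)[symmetric] s' v' u'] assms(1)
    by (cases "tu < tv") auto
  \<comment> \<open>Up to here \<open>r\<close> and \<open>s\<close> might still lie on opposite
    sides of the segment \<open>u v\<close>; then \<open>u\<close> would lie between them, which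
    this excludes.\<close>
  moreover have "tu < min tr ts \<or> max tr ts < tu"
    using not_between_if_above[OF _ assms(1) u r s] not_between_if_above[OF _ assms(1) u' s r] assms(2)
    by (cases "tr < ts") auto
  ultimately show ?thesis unfolding min_def max_def by (cases "tu \<le> tv"; cases "tr \<le> ts"; simp) linarith+
qed

section \<open>Generic placements and trapped quadruples\<close>

definition generic_on :: "'v set \<Rightarrow> ('v \<Rightarrow> real^2) \<Rightarrow> bool" where
  "generic_on V p \<longleftrightarrow>
     (\<forall>x\<in>V. \<forall>y\<in>V. \<forall>z\<in>V. x \<noteq> y \<and> y \<noteq> z \<and> x \<noteq> z \<longrightarrow> orient (p x) (p y) (p z) \<noteq> 0)"

lemma generic_onD:
  "\<lbrakk>generic_on V p; x \<in> V; y \<in> V; z \<in> V; x \<noteq> y; y \<noteq> z; x \<noteq> z\<rbrakk> \<Longrightarrow> orient (p x) (p y) (p z) \<noteq> 0"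
  by (simp add: generic_on_def)

lemma generic_on_reindex:
  assumes "generic_on V p" "inj_on c U" "c ` U \<subseteq> V"
  shows "generic_on U (\<lambda>x. p (c x))"
  unfolding generic_on_def
proof (intro ballI impI)
  fix x y z assume *: "x \<in> U" "y \<in> U" "z \<in> U" "x \<noteq> y \<and> y \<noteq> z \<and> x \<noteq> z"
  then have "c x \<noteq> c y" "c y \<noteq> c z" "c x \<noteq> c z" using assms(2) by (auto dest: inj_onD)
  then show "orient (p (c x)) (p (c y)) (p (c z)) \<noteq> 0"
    using assms(3) * by (intro generic_onD[OF assms(1)]) auto
qed

definition trapped :: "('v \<Rightarrow> 'v \<Rightarrow> bool) \<Rightarrow> ('v \<Rightarrow> real^2) \<Rightarrow> 'v \<Rightarrow> 'v \<Rightarrow> 'v \<Rightarrow> 'v \<Rightarrow> bool" where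
  "trapped adj p u v a b \<longleftrightarrow> \<not> adj u v \<and> adj u a \<and> adj v a \<and> adj u b \<and> adj v b \<and>
     orient (p u) (p v) (p a) > 0 \<and> orient (p u) (p v) (p b) < 0"

text \<open>
  The complement of the disjoint union of the 9-cycle \<open>0, \<dots>, 8\<close> and the edge \<open>{9, 10}\<close>. Suppose that
  no quadruple of a placement is trapped. Then all points of the cycle are on one side of the line
  through \<open>9\<close> and \<open>10\<close>, and seen from \<open>9\<close> any two cycle edges at distance at least two are
  separated. This is impossible: removing one of the cycle edges \<open>01\<close>, \<open>34\<close>, \<open>67\<close> with its
  neighbours leaves a path joining the other two, so none of the three can be in the middle.
\<close>

definition kernel_adj :: "nat \<Rightarrow> nat \<Rightarrow> bool" where
  "kernel_adj x y \<longleftrightarrow> x \<noteq> y \<and> {x, y} \<noteq> {9, 10} \<and>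
     \<not> (x < 9 \<and> y < 9 \<and> (y = (x + 1) mod 9 \<or> x = (y + 1) mod 9))"

lemma kernel_adj_sym: "kernel_adj x y \<longleftrightarrow> kernel_adj y x"
  by (auto simp: kernel_adj_def insert_commute)

text \<open>\<open>X\<close> and \<open>orient k k'\<close> are orthogonal coordinates along and
  across the line \<open>k k'\<close>, both stretched by its length; areas are therefore multiplied
  by the squared length \<open>N\<close>.\<close>

lemma orient_in_frame:
  fixes k k' :: "real^2"
  defines "N \<equiv> (k'$1 - k$1)\<^sup>2 + (k'$2 - k$2)\<^sup>2"
    and "X \<equiv> \<lambda>z. (z$1 - k$1) * (k'$1 - k$1) + (z$2 - k$2) * (k'$2 - k$2)"
  shows "N * orient u v r = (X v - X u) * (orient k k' r - orient k k' u)
      - (X r - X u) * (orient k k' v - orient k k' u)"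
  by (simp add: assms orient_def power2_eq_square algebra_simps)

lemma kernel_trapped:
  fixes q :: "nat \<Rightarrow> real^2"
  assumes "generic_on {..<11} q"
  shows "\<exists>u<11. \<exists>v<11. \<exists>a<11. \<exists>b<11. trapped kernel_adj q u v a b"
proof (rule ccontr)
  assume neg: "\<not> ?thesis"
  have gp: "orient (q i) (q j) (q k) \<noteq> 0"
    if "i < 11" "j < 11" "k < 11" "i \<noteq> j" "j \<noteq> k" "i \<noteq> k" for i j k
    using generic_onD[OF assms] that by simp
  have same: "orient (q u) (q v) (q a) * orient (q u) (q v) (q b) > 0"
    if "u < 11" "v < 11" "a < 11" "b < 11" "u \<noteq> v" "\<not> kernel_adj u v"
      "kernel_adj u a" "kernel_adj v a" "kernel_adj u b" "kernel_adj v b" for u v a b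
  proof -
    have "a \<noteq> u" "a \<noteq> v" "b \<noteq> u" "b \<noteq> v" using that by (auto simp: kernel_adj_def)
    then have "orient (q u) (q v) (q a) \<noteq> 0" "orient (q u) (q v) (q b) \<noteq> 0"
      using gp that by auto
    then show ?thesis using neg that unfolding trapped_def
      by (metis linorder_neqE_linordered_idom zero_less_mult_iff)
  qed
  define k k' where "k = q 9" and "k' = q 10"
  define N where "N = (k'$1 - k$1)\<^sup>2 + (k'$2 - k$2)\<^sup>2"
  define X where "X = (\<lambda>z::real^2. (z$1 - k$1) * (k'$1 - k$1) + (z$2 - k$2) * (k'$2 - k$2))"
  define \<sigma> where "\<sigma> = orient k k' (q 0)"
  define h where "h = (\<lambda>i. orient k k' (q i) * \<sigma>)"
  \<comment> \<open>In frame coordinates, passing from \<open>(X, h)\<close> to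
    \<open>(X / h, 1 / h)\<close> is a projective map sending the line \<open>k k'\<close> to
    infinity and \<open>k\<close> to the vertical direction. So \<open>t\<close> orders the cycle
    points by the direction in which \<open>k\<close> sees them, and lying on the same side of a
    line as \<open>k\<close> becomes lying above it.\<close>
  define t where "t = (\<lambda>i. X (q i) / h i)"
  define w where "w = (\<lambda>i. 1 / h i)"
  have h: "h i > 0" if "i < 9" for i
    using same[of 9 10 i 0] that unfolding h_def \<sigma>_def k_def k'_def
    by (auto simp: kernel_adj_def doubleton_eq_iff)
  have "\<sigma> \<noteq> 0" using gp[of 9 10 0] by (simp add: \<sigma>_def k_def k'_def)
  have "k \<noteq> k'" using h[of 0] unfolding h_def by auto
  then have "N > 0" unfolding N_def
    by (metis eq_iff_diff_eq_0 sum_power2_gt_zero_iff vec2_eq_iff)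
  have ork: "N * \<sigma> * orient (q u) (q v) k = - (h u * h v * (t v - t u))"
    if "u < 9" "v < 9" for u v
  proof -
    have "X k = 0" by (simp add: X_def)
    have "N * orient (q u) (q v) k =
       (X (q v) - X (q u)) * (0 - orient k k' (q u)) - (0 - X (q u)) * (orient k k' (q v) - orient k k' (q u))"
      unfolding N_def using orient_in_frame[of k' k "q u" "q v" k] \<open>X k = 0\<close> by (simp add: X_def)
    then have "\<sigma> * (N * orient (q u) (q v) k) = X (q u) * h v - X (q v) * h u"
      by (simp only: h_def) (simp add: algebra_simps)
    then have "N * \<sigma> * orient (q u) (q v) k = X (q u) * h v - X (q v) * h u"
      by (simp add: mult.assoc mult.left_commute)
    moreover have "X (q u) = t u * h u" "X (q v) = t v * h v" using h that by (simp_all add: t_def less_imp_neq[symmetric])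
    ultimately show ?thesis by (simp add: algebra_simps)
  qed
  have orr: "N * \<sigma> * orient (q u) (q v) (q r) =
      - (h u * h v * h r * ((t v - t u) * (w r - w u) - (t r - t u) * (w v - w u)))"
    if "u < 9" "v < 9" "r < 9" for u v r
  proof -
    have eq: "X (q i) = t i * h i" "h i * w i = 1" if "i < 9" for i
      using h[OF that] by (simp_all add: t_def w_def)
    have "N * orient (q u) (q v) (q r) =
       (X (q v) - X (q u)) * (orient k k' (q r) - orient k k' (q u)) - (X (q r) - X (q u)) * (orient k k' (q v) - orient k k' (q u))"
      unfolding N_def using orient_in_frame[of k' k "q u" "q v" "q r"] by (simp add: X_def)
    then have "\<sigma> * (N * orient (q u) (q v) (q r)) =
        (X (q v) - X (q u)) * (h r - h u) - (X (q r) - X (q u)) * (h v - h u)"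
      by (simp only: h_def) (simp add: algebra_simps)
    also have "\<dots> = - ((t v - t u) * (h u * h v * (h r * w r) - h v * h r * (h u * w u))
        - (t r - t u) * (h u * h r * (h v * w v) - h v * h r * (h u * w u)))"
      unfolding eq(1)[OF \<open>u < 9\<close>] eq(1)[OF \<open>v < 9\<close>] eq(1)[OF \<open>r < 9\<close>]
        eq(2)[OF \<open>u < 9\<close>] eq(2)[OF \<open>v < 9\<close>] eq(2)[OF \<open>r < 9\<close>]
      by (simp add: algebra_simps)
    also have "\<dots> = - (h u * h v * h r * ((t v - t u) * (w r - w u) - (t r - t u) * (w v - w u)))"
      by (simp add: algebra_simps)
    finally show ?thesis by (simp add: mult.assoc mult.left_commute)
  qed
  \<comment> \<open>The vertex 9, placed at \<open>k\<close>, is a common neighbour of the ends of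
    every cycle edge, so \<open>same\<close> may compare \<open>r\<close> with
    \<open>k\<close>.\<close>
  have above: "(t v - t u) * ((t v - t u) * (w r - w u) - (t r - t u) * (w v - w u)) > 0 \<and> t u \<noteq> t v"
    if "u < 9" "v < 9" "r < 9" "u \<noteq> v" "\<not> kernel_adj u v" "kernel_adj u r" "kernel_adj v r" for u v r
  proof -
    let ?D = "(t v - t u) * (w r - w u) - (t r - t u) * (w v - w u)"
    have "orient (q u) (q v) k * orient (q u) (q v) (q r) > 0"
      unfolding k_def using that by (intro same) (auto simp: kernel_adj_def doubleton_eq_iff)
    then have "(N * \<sigma> * orient (q u) (q v) k) * (N * \<sigma> * orient (q u) (q v) (q r)) > 0"
      using \<open>N > 0\<close> \<open>\<sigma> \<noteq> 0\<close> by (auto simp: zero_less_mult_iff mult_less_0_iff)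
    then have "(h u * h v * (t v - t u)) * (h u * h v * h r * ?D) > 0"
      unfolding ork[OF that(1,2)] orr[OF that(1-3)] by simp
    also have "(h u * h v * (t v - t u)) * (h u * h v * h r * ?D) = (h u * h v * h u * h v * h r) * ((t v - t u) * ?D)"
      by (simp add: algebra_simps)
    finally have "(h u * h v * h u * h v * h r) * ((t v - t u) * ?D) > 0" .
    moreover have "h u * h v * h u * h v * h r > 0" using h that by simp
    ultimately have "(t v - t u) * ?D > 0" using zero_less_mult_pos by blast
    then show ?thesis by auto
  qed
  have sep: "(t u < t r \<and> t u < t s \<and> t v < t r \<and> t v < t s) \<or> (t r < t u \<and> t s < t u \<and> t r < t v \<and> t s < t v)"
    if "u < 9" "v < 9" "r < 9" "s < 9" "u \<noteq> v" "\<not> kernel_adj u v" "r \<noteq> s" "\<not> kernel_adj r s"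
      "kernel_adj u r" "kernel_adj v r" "kernel_adj u s" "kernel_adj v s" for u v r s
  proof -
    have *: "kernel_adj r u" "kernel_adj s u" "kernel_adj r v" "kernel_adj s v"
      using that by (simp_all add: kernel_adj_sym)
    show ?thesis
      using above[OF that(1,2,3,5,6,9,10)] above[OF that(1,2,4,5,6,11,12)]
        above[OF that(3,4,1,7,8) *(1,2)] above[OF that(3,4,2,7,8) *(3,4)]
        separated_if_mutually_above[where tu = "t u" and tv = "t v" and tr = "t r" and ts = "t s"
          and wu = "w u" and wv = "w v" and wr = "w r" and ws = "w s"]
      by blast
  qed
  note kernel = kernel_adj_def doubleton_eq_iff
  \<comment> \<open>The edge 01 is separated from each edge of the path 3, 4, 5, 6. Successive edges
    share a vertex, so the whole path is on one side of 01. The next two claims use the paths 6, 7,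
    8, 0 and 0, 1, 2, 3 in the same way; together they say that none of \<open>t 0\<close>,
    \<open>t 3\<close>, \<open>t 6\<close> is the middle one.\<close>
  have "(t 0 < t 3 \<and> t 0 < t 6 \<and> t 1 < t 3 \<and> t 1 < t 6 \<or> t 0 > t 3 \<and> t 0 > t 6 \<and> t 1 > t 3 \<and> t 1 > t 6)"
    using sep[of 0 1 3 4] sep[of 0 1 4 5] sep[of 0 1 5 6] by (auto simp: kernel)
  moreover have "(t 3 < t 6 \<and> t 3 < t 0 \<or> t 3 > t 6 \<and> t 3 > t 0)"
    using sep[of 3 4 6 7] sep[of 3 4 7 8] sep[of 3 4 8 0] by (auto simp: kernel)
  moreover have "(t 6 < t 0 \<and> t 6 < t 3 \<or> t 6 > t 0 \<and> t 6 > t 3)"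
    using sep[of 6 7 0 1] sep[of 6 7 1 2] sep[of 6 7 2 3] by (auto simp: kernel)
  ultimately show False by linarith
qed

section \<open>Lexicographic powers\<close>

fun lex_adj :: "nat list \<Rightarrow> nat list \<Rightarrow> bool" where
  "lex_adj (x # xs) (y # ys) = (if x = y then lex_adj xs ys else kernel_adj x y)"
| "lex_adj _ _ = False"

definition lex_verts :: "nat \<Rightarrow> nat list set" where
  "lex_verts n = {xs. set xs \<subseteq> {..<11} \<and> length xs = n}"

lemma lex_adj_sym: "lex_adj xs ys \<longleftrightarrow> lex_adj ys xs"
proof (induction xs ys rule: lex_adj.induct)
  case (1 x xs y ys)
  then show ?case by (auto simp: kernel_adj_sym)
qed auto

lemma finite_lex_verts: "finite (lex_verts n)"
  unfolding lex_verts_def by (rule finite_lists_length_eq) simp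

lemma Cons_in_lex_verts [simp]: "x # xs \<in> lex_verts (Suc n) \<longleftrightarrow> x < 11 \<and> xs \<in> lex_verts n"
  by (auto simp: lex_verts_def)

text \<open>Distinct heads alone decide adjacency, so one word per head, with an arbitrary tail
  \<open>d\<close>, spans an induced copy of the kernel.\<close>

lemma transversal_trapped:
  assumes gen: "generic_on (lex_verts (Suc n)) p"
    and d: "\<And>x. x < 11 \<Longrightarrow> d x \<in> lex_verts n"
  shows "\<exists>u<11. \<exists>v<11. \<exists>a<11. \<exists>b<11. trapped lex_adj p (u # d u) (v # d v) (a # d a) (b # d b)"
proof -
  have "\<exists>u<11. \<exists>v<11. \<exists>a<11. \<exists>b<11. trapped kernel_adj (\<lambda>x. p (x # d x)) u v a b"
    by (intro kernel_trapped generic_on_reindex[OF gen]) (use d in \<open>auto simp: inj_on_def\<close>)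
  then obtain u v a b where *: "u < 11" "v < 11" "a < 11" "b < 11"
    and tr: "trapped kernel_adj (\<lambda>x. p (x # d x)) u v a b" by blast
  \<comment> \<open>Non-adjacency would allow equality; the non-zero orientation rules it
    out.\<close>
  have "u \<noteq> v" using tr by (auto simp: trapped_def)
  moreover have "u \<noteq> a" "v \<noteq> a" "u \<noteq> b" "v \<noteq> b" using tr by (auto simp: trapped_def kernel_adj_def)
  ultimately have "trapped lex_adj p (u # d u) (v # d v) (a # d a) (b # d b)"
    using tr by (simp add: trapped_def)
  then show ?thesis using * by blast
qed

lemma convex_first_coord:
  "convex {w::real^2. w$1 \<le> t}" "convex {w::real^2. t < w$1}"
  using convex_halfspace_le[of "axis 1 1 :: real^2" t] convex_halfspace_gt[of t "axis 1 1 :: real^2"]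
  by (simp_all add: inner_axis')

text \<open>
  Sweep a vertical line from the left until some quadruple is trapped on or to the left of it. Were
  all eleven blocks of the outermost substitution hit strictly to the left, a transversal would
  already contain a trapped quadruple. So some block lies weakly to the right, and as at most two
  points are on the line, some sub-block lies strictly to the right.
\<close>

lemma separated_trapped_quadruples:
  fixes p :: "nat list \<Rightarrow> real^2"
  assumes "generic_on (lex_verts (2 * h)) p"
  shows "\<exists>\<C>. finite \<C> \<and> card \<C> = h \<and> pairwise disjnt \<C> \<and> (\<forall>C\<in>\<C>. \<exists>u v a b.
      {u, v, a, b} \<subseteq> lex_verts (2 * h) \<and> trapped lex_adj p u v a b \<and> C = convex hull {p u, p v, p a, p b})"
  using assms
proof (induction h arbitrary: p)
  case 0
  show ?case by (rule exI[of _ "{}"]) auto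
next
  case (Suc h)
  define V where "V = lex_verts (Suc (Suc (2 * h)))"
  have V: "lex_verts (2 * Suc h) = V" by (simp add: V_def)
  have gen: "generic_on V p" using Suc.prems unfolding V .
  define \<Q> where "\<Q> = {(u, v, a, b). {u, v, a, b} \<subseteq> V \<and> trapped lex_adj p u v a b}"
  \<comment> \<open>The position of the sweep line at which the quadruple has been passed
    completely; a minimiser is the first trapped quadruple met.\<close>
  define f where "f = (\<lambda>(u, v, a, b). Max ((\<lambda>x. p x $ 1) ` {u, v, a, b}))"
  have trans: "\<exists>u<11. \<exists>v<11. \<exists>a<11. \<exists>b<11. (u # d u, v # d v, a # d a, b # d b) \<in> \<Q>"
    if d: "\<And>x. x < 11 \<Longrightarrow> d x \<in> lex_verts (Suc (2 * h))" for d
  proof -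
    have "\<exists>u<11. \<exists>v<11. \<exists>a<11. \<exists>b<11. trapped lex_adj p (u # d u) (v # d v) (a # d a) (b # d b)"
      by (rule transversal_trapped[OF gen[unfolded V_def] d])
    then obtain u v a b where *: "u < 11" "v < 11" "a < 11" "b < 11"
      "trapped lex_adj p (u # d u) (v # d v) (a # d a) (b # d b)"
      by blast
    then have "(u # d u, v # d v, a # d a, b # d b) \<in> \<Q>"
      using d by (simp add: \<Q>_def V_def)
    then show ?thesis using * by blast
  qed
  have "finite \<Q>"
  proof (rule finite_subset)
    show "\<Q> \<subseteq> V \<times> V \<times> V \<times> V" by (auto simp: \<Q>_def)
    show "finite (V \<times> V \<times> V \<times> V)" by (simp add: V_def finite_lex_verts)
  qed
  moreover have "replicate (Suc (2 * h)) 0 \<in> lex_verts (Suc (2 * h))" by (auto simp: lex_verts_def)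
  then have "\<Q> \<noteq> {}" using trans[of "\<lambda>_. replicate (Suc (2 * h)) 0"] by blast
  ultimately obtain Q where "Q \<in> \<Q>" and min: "\<And>Q'. Q' \<in> \<Q> \<Longrightarrow> f Q \<le> f Q'"
    using arg_min_if_finite[of \<Q> f] that[of "arg_min_on f \<Q>"] by (meson not_le_imp_less)
  obtain u v a b where Q: "Q = (u, v, a, b)" by (cases Q)
  have uvab: "{u, v, a, b} \<subseteq> V" "trapped lex_adj p u v a b" using \<open>Q \<in> \<Q>\<close> by (auto simp: Q \<Q>_def)
  define t where "t = f Q"
  have left: "p x $ 1 \<le> t" if "x \<in> {u, v, a, b}" for x
    unfolding t_def f_def Q using that by (auto intro: Max_ge)
  obtain x where x: "x < 11" "\<And>z. z \<in> lex_verts (Suc (2 * h)) \<Longrightarrow> t \<le> p (x # z) $ 1"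
  proof (rule ccontr)
    assume "\<not> thesis"
    then have "\<forall>x. \<exists>z. x < 11 \<longrightarrow> z \<in> lex_verts (Suc (2 * h)) \<and> p (x # z) $ 1 < t"
      using that by (metis not_le_imp_less)
    then obtain d where d: "\<And>x. x < 11 \<Longrightarrow> d x \<in> lex_verts (Suc (2 * h))" "\<And>x. x < 11 \<Longrightarrow> p (x # d x) $ 1 < t"
      by metis
    obtain u' v' a' b' where *: "u' < 11" "v' < 11" "a' < 11" "b' < 11"
      "(u' # d u', v' # d v', a' # d a', b' # d b') \<in> \<Q>"
      using trans[of d] d(1) by blast
    then have "f (u' # d u', v' # d v', a' # d a', b' # d b') < t"
      using d(2) by (simp add: f_def)
    then show False using min[OF *(5)] by (simp add: t_def)
  qed
  obtain y where y: "y < 11" "\<And>z. z \<in> lex_verts (2 * h) \<Longrightarrow> t < p (x # y # z) $ 1"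
  proof (rule ccontr)
    assume "\<not> thesis"
    then have "\<forall>y. \<exists>z. y < 11 \<longrightarrow> z \<in> lex_verts (2 * h) \<and> p (x # y # z) $ 1 \<le> t"
      using that by (metis not_le_imp_less)
    then obtain d where d: "\<And>y. y < 11 \<Longrightarrow> d y \<in> lex_verts (2 * h)" "\<And>y. y < 11 \<Longrightarrow> p (x # y # d y) $ 1 \<le> t"
      by metis
    have eq: "p (x # y # d y) $ 1 = t" if "y < 11" for y
      using x(2)[of "y # d y"] d(1)[OF that] d(2)[OF that] that by simp
    \<comment> \<open>All eleven chosen points are on the vertical line at \<open>t\<close>; three
      of them already violate genericity.\<close>
    have "orient (p (x # 0 # d 0)) (p (x # 1 # d 1)) (p (x # 2 # d 2)) \<noteq> 0"
      by (rule generic_onD[OF gen]) (simp_all add: V_def x(1) d(1))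
    then show False using eq[of 0] eq[of 1] eq[of 2] by (simp add: orient_def)
  qed
  \<comment> \<open>Words with the common prefix \<open>x, y\<close> form a copy of the power with
    exponent \<open>2 * h\<close>, since equal leading digits are skipped in adjacency. This copy
    lies strictly to the right of the sweep line.\<close>
  define p' where "p' = (\<lambda>z. p (x # y # z))"
  have "generic_on (lex_verts (2 * h)) p'" unfolding p'_def
    by (rule generic_on_reindex[OF gen]) (auto simp: V_def inj_on_def x(1) y(1))
  from Suc.IH[OF this] obtain \<C> where \<C>: "finite \<C>" "card \<C> = h" "pairwise disjnt \<C>"
    and IH: "\<forall>C\<in>\<C>. \<exists>u v a b. {u, v, a, b} \<subseteq> lex_verts (2 * h) \<and> trapped lex_adj p' u v a b \<and>
      C = convex hull {p' u, p' v, p' a, p' b}"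
    by blast
  define C\<^sub>0 where "C\<^sub>0 = convex hull {p u, p v, p a, p b}"
  have C0: "C\<^sub>0 \<subseteq> {w. w$1 \<le> t}" unfolding C\<^sub>0_def
    by (rule hull_minimal) (use left in blast, rule convex_first_coord)
  have right: "C \<subseteq> {w. t < w$1} \<and> C \<noteq> {}" if C: "C \<in> \<C>" for C
  proof -
    obtain u v a b where *: "{u, v, a, b} \<subseteq> lex_verts (2 * h)"
      "C = convex hull {p' u, p' v, p' a, p' b}"
      using bspec[OF IH C] by (elim exE conjE) (rule that)
    have "{p' u, p' v, p' a, p' b} \<subseteq> {w. t < w$1}" using *(1) y(2) by (simp add: p'_def)
    then have "C \<subseteq> {w. t < w$1}" unfolding *(2)
      by (rule hull_minimal) (rule convex_first_coord)
    then show ?thesis unfolding *(2) by simp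
  qed
  have disj: "disjnt C\<^sub>0 C" "disjnt C C\<^sub>0" if "C \<in> \<C>" for C
    using C0 right[OF that] by (force simp: disjnt_iff)+
  \<comment> \<open>Disjointness alone would not separate the new hull from the old ones, as the
    empty set is disjoint from itself; non-emptiness of the hulls matters here.\<close>
  have "C\<^sub>0 \<notin> \<C>" using disj right by (metis disjnt_self_iff_empty)
  show ?case
  proof (intro exI[of _ "insert C\<^sub>0 \<C>"] conjI ballI)
    show "card (insert C\<^sub>0 \<C>) = Suc h" using \<open>C\<^sub>0 \<notin> \<C>\<close> \<C> by simp
    show "pairwise disjnt (insert C\<^sub>0 \<C>)" using \<C>(3) disj by (simp add: pairwise_insert)
  next
    fix C assume "C \<in> insert C\<^sub>0 \<C>"
    then show "\<exists>u v a b. {u, v, a, b} \<subseteq> lex_verts (2 * Suc h) \<and> trapped lex_adj p u v a b \<and>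
        C = convex hull {p u, p v, p a, p b}"
    proof
      assume "C = C\<^sub>0"
      then show ?thesis using uvab unfolding V C\<^sub>0_def by (intro exI conjI)
    next
      assume C: "C \<in> \<C>"
      obtain u v a b where *: "{u, v, a, b} \<subseteq> lex_verts (2 * h)"
        "trapped lex_adj p' u v a b" "C = convex hull {p' u, p' v, p' a, p' b}"
        using bspec[OF IH C] by (elim exE conjE) (rule that)
      have "{x # y # u, x # y # v, x # y # a, x # y # b} \<subseteq> V"
        using *(1) x(1) y(1) by (simp add: V_def)
      moreover have "trapped lex_adj p (x # y # u) (x # y # v) (x # y # a) (x # y # b)"
        using *(2) by (simp add: trapped_def p'_def)
      ultimately show ?thesis unfolding V using *(3) unfolding p'_def by (intro exI conjI)
    qed
  qed (use \<C> in auto)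
qed

section \<open>Lower bound on the number of obstacles\<close>

text \<open>Some obstacle blocks the non-adjacent pair of each trapped quadruple and misses the four
  sides, hence stays in the hull; disjoint hulls give distinct obstacles. The map \<open>e\<close>
  embeds the power as an induced subgraph on another vertex type.\<close>

lemma card_obstacles_ge:
  assumes rep: "obstacle_representation G p \<O>"
    and e: "inj_on e (lex_verts (2 * h))" "e ` lex_verts (2 * h) \<subseteq> pverts G"
    and adj: "\<And>x y. \<lbrakk>x \<in> lex_verts (2 * h); y \<in> lex_verts (2 * h); x \<noteq> y\<rbrakk>
      \<Longrightarrow> (e x, e y) \<in> parcs G \<longleftrightarrow> lex_adj x y"
  shows "h \<le> card \<O>"
proof -
  let ?V = "lex_verts (2 * h)"
  note rep = rep[unfolded obstacle_representation_def]
  have inj: "inj_on (p \<circ> e) ?V"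
    using rep e by (meson comp_inj_on inj_on_subset)
  \<comment> \<open>\<open>generic_on\<close> speaks of distinct indices,
    \<open>general_position\<close> of distinct points; injectivity bridges the two.\<close>
  have "generic_on ?V (p \<circ> e)" unfolding generic_on_def
  proof (intro ballI impI)
    fix x y z assume *: "x \<in> ?V" "y \<in> ?V" "z \<in> ?V" "x \<noteq> y \<and> y \<noteq> z \<and> x \<noteq> z"
    then have "(p \<circ> e) x \<noteq> (p \<circ> e) y" "(p \<circ> e) y \<noteq> (p \<circ> e) z" "(p \<circ> e) x \<noteq> (p \<circ> e) z"
      by (simp_all only: inj_on_eq_iff[OF inj]) simp_all
    moreover have "(p \<circ> e) w \<in> p ` pverts G" if "w \<in> ?V" for w using that e by auto
    moreover have "general_position (p ` pverts G \<union> (\<Union>S\<in>\<O>. region_vertices S))"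
      using rep by (elim conjE)
    ultimately have "\<not> collinear {(p \<circ> e) x, (p \<circ> e) y, (p \<circ> e) z}"
      using *(1-3) unfolding general_position_def by (metis UnI1)
    then show "orient ((p \<circ> e) x) ((p \<circ> e) y) ((p \<circ> e) z) \<noteq> 0"
      by (simp only: collinear_iff_orient not_False_eq_True)
  qed
  from separated_trapped_quadruples[OF this] obtain \<C> where
    \<C>: "finite \<C>" "card \<C> = h" "pairwise disjnt \<C>"
    and trap: "\<forall>C\<in>\<C>. \<exists>u v a b. {u, v, a, b} \<subseteq> ?V \<and> trapped lex_adj (p \<circ> e) u v a b \<and>
      C = convex hull {(p \<circ> e) u, (p \<circ> e) v, (p \<circ> e) a, (p \<circ> e) b}"
    by (elim exE conjE) (rule that)
  have "\<exists>S\<in>\<O>. S \<subseteq> C \<and> S \<noteq> {}" if C: "C \<in> \<C>" for C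
  proof -
    obtain u v a b where uvab: "{u, v, a, b} \<subseteq> ?V"
      and tr: "trapped lex_adj (p \<circ> e) u v a b"
      and C: "C = convex hull {(p \<circ> e) u, (p \<circ> e) v, (p \<circ> e) a, (p \<circ> e) b}"
      using bspec[OF trap C] by (elim exE conjE) (rule that)
    have *: "x \<noteq> y \<Longrightarrow> lex_adj x y \<longleftrightarrow> (\<forall>S\<in>\<O>. closed_segment (p (e x)) (p (e y)) \<inter> S = {})"
      if "x \<in> ?V" "y \<in> ?V" for x y
    proof -
      assume "x \<noteq> y"
      then have "e x \<noteq> e y" using e(1) that by (auto dest: inj_onD)
      moreover have "e x \<in> pverts G" "e y \<in> pverts G" using e(2) that by auto
      ultimately show ?thesis using rep adj[OF that \<open>x \<noteq> y\<close>] by blast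
    qed
    have ne: "u \<noteq> v" "u \<noteq> a" "v \<noteq> a" "u \<noteq> b" "v \<noteq> b"
      using tr by (auto simp: trapped_def)
    obtain S z where S: "S \<in> \<O>" "z \<in> S" "z \<in> closed_segment (p (e u)) (p (e v))"
      using *[of u v] uvab ne tr by (auto simp: trapped_def)
    have "connected S" using rep S by (auto simp: polygonal_obstacle_def)
    moreover have "closed_segment (p (e u)) (p (e a)) \<inter> S = {}" "closed_segment (p (e v)) (p (e a)) \<inter> S = {}"
      "closed_segment (p (e u)) (p (e b)) \<inter> S = {}" "closed_segment (p (e v)) (p (e b)) \<inter> S = {}"
      using *[of u a] *[of v a] *[of u b] *[of v b] uvab ne tr S by (auto simp: trapped_def)
    ultimately have "S \<subseteq> C"
      unfolding C comp_def using tr S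
      by (intro connected_confined_by_quadrilateral[where z = z]) (auto simp: trapped_def)
    then show ?thesis using S by blast
  qed
  then obtain g where g: "\<And>C. C \<in> \<C> \<Longrightarrow> g C \<in> \<O> \<and> g C \<subseteq> C \<and> g C \<noteq> {}" by metis
  have "inj_on g \<C>"
  proof (rule inj_onI, rule ccontr)
    fix C C' assume *: "C \<in> \<C>" "C' \<in> \<C>" "g C = g C'" "C \<noteq> C'"
    then have "disjnt C C'" using \<C>(3) by (auto dest: pairwiseD)
    then show False using g[OF *(1)] g[OF *(2)] *(3) by (auto simp: disjnt_def)
  qed
  moreover have "g ` \<C> \<subseteq> \<O>" using g by blast
  moreover have "finite \<O>" using rep by blast
  ultimately show ?thesis using \<C>(2) card_inj_on_le by metis
qed

section \<open>Vertices of polygonal regions\<close>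

lemma inner_vec2: "a \<bullet> x = a$1 * x$1 + a$2 * x$2" for a x :: "real^2"
  by (simp add: inner_vec_def sum_2)

text \<open>Passes from the normal form of half-plane boundaries to the two-point form in
  \<open>region_vertices\<close>; the second point is \<open>v\<close> moved by \<open>a\<close>
  turned through a right angle.\<close>

lemma line_eq_affine_hull:
  fixes a v :: "real^2"
  assumes "a \<noteq> 0" "a \<bullet> v = b"
  shows "\<exists>w. w \<noteq> v \<and> {x. a \<bullet> x = b} = affine hull {v, w}"
proof -
  define d :: "real^2" where "d = vector [- a$2, a$1]"
  have d: "d$1 = - a$2" "d$2 = a$1" by (simp_all add: d_def)
  have "d \<noteq> 0" using assms(1) d by (auto simp: vec2_eq_iff)
  define N where "N = a$1 * a$1 + a$2 * a$2"
  have "N \<noteq> 0" using assms(1) unfolding N_def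
    by (simp add: vec2_eq_iff sum_squares_eq_zero_iff)
  have "{x. a \<bullet> x = b} = affine hull {v, v + d}"
  proof (intro set_eqI iffI)
    fix x assume "x \<in> {x. a \<bullet> x = b}"
    then have *: "a$1 * (x$1 - v$1) + a$2 * (x$2 - v$2) = 0"
      using assms(2) by (simp add: inner_vec2 algebra_simps)
    define t where "t = (d \<bullet> (x - v)) / N"
    have tN: "t * N = a$1 * (x$2 - v$2) - a$2 * (x$1 - v$1)"
      using \<open>N \<noteq> 0\<close> by (simp add: t_def inner_vec2 d)
    have "N * (x$1 - v$1) = N * (t * d$1)" "N * (x$2 - v$2) = N * (t * d$2)"
      using * tN unfolding N_def d by algebra+
    then have "x$1 - v$1 = t * d$1" "x$2 - v$2 = t * d$2" using \<open>N \<noteq> 0\<close> by simp_all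
    then have "x = (1 - t) *\<^sub>R v + t *\<^sub>R (v + d)"
      by (simp add: vec2_eq_iff algebra_simps)
    moreover have "(1 - t) + t = 1" by simp
    ultimately show "x \<in> affine hull {v, v + d}"
      unfolding affine_hull_2 by blast
  next
    fix x assume "x \<in> affine hull {v, v + d}"
    then obtain s t where st: "s + t = 1" "x = s *\<^sub>R v + t *\<^sub>R (v + d)"
      unfolding affine_hull_2 by auto
    then have s: "s = 1 - t" by simp
    have "x = v + t *\<^sub>R d" unfolding st(2) s by (simp add: algebra_simps)
    then show "x \<in> {x. a \<bullet> x = b}"
      using assms(2) by (simp add: inner_vec2 d algebra_simps)
  qed
  then show ?thesis using \<open>d \<noteq> 0\<close> by (intro exI[of _ "v + d"]) simp
qed

lemma parallel_imp_scaled: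
  fixes a a' :: "real^2"
  assumes "a \<noteq> 0" "a' \<noteq> 0" "a$1 * a'$2 = a$2 * a'$1"
  shows "\<exists>c. c \<noteq> 0 \<and> a' = c *\<^sub>R a"
proof (cases "a$1 = 0")
  case True
  then have "a$2 \<noteq> 0" using assms(1) by (simp add: vec2_eq_iff)
  then have "a' = (a'$2 / a$2) *\<^sub>R a" using assms True by (simp add: vec2_eq_iff)
  then show ?thesis using assms(2) by (metis scaleR_zero_left)
next
  case False
  then have "a' = (a'$1 / a$1) *\<^sub>R a" using assms by (simp add: vec2_eq_iff eq_divide_eq mult.commute)
  then show ?thesis using assms(2) by (metis scaleR_zero_left)
qed

lemma eventually_same_side:
  fixes a v :: "'a::real_inner"
  assumes "a \<bullet> v \<noteq> b"
  shows "\<forall>\<^sub>F x in nhds v. a \<bullet> x \<le> b \<longleftrightarrow> a \<bullet> v \<le> b"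
proof (cases "a \<bullet> v < b")
  case True
  then have "\<forall>\<^sub>F x in nhds v. x \<in> {x. a \<bullet> x < b}"
    by (intro eventually_nhds_in_open open_halfspace_lt) simp
  then show ?thesis using True by (auto elim: eventually_mono)
next
  case False
  then have "\<forall>\<^sub>F x in nhds v. x \<in> {x. a \<bullet> x > b}"
    using assms by (intro eventually_nhds_in_open open_halfspace_gt) simp
  then show ?thesis using False assms by (auto elim!: eventually_mono)
qed

text \<open>
  Near a boundary point that lies on only one of the lines bounding the half-planes of \<open>H\<close>,
  membership in \<open>S\<close> depends only on the side of this line, so the boundary of \<open>S\<close> is this line.
\<close>

lemma region_vertices_subset_crossings:
  fixes H :: "((real^2) \<times> real) set"
  assumes fin: "finite H" and nz: "\<And>a b. (a, b) \<in> H \<Longrightarrow> a \<noteq> 0" and "closed S"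
    and det: "\<And>x y. \<lbrakk>\<And>a b. (a, b) \<in> H \<Longrightarrow> a \<bullet> x \<le> b \<longleftrightarrow> a \<bullet> y \<le> b; x \<in> S\<rbrakk> \<Longrightarrow> y \<in> S"
    and v: "v \<in> region_vertices S"
  shows "\<exists>a b a' b'. (a, b) \<in> H \<and> (a', b') \<in> H \<and> a \<bullet> v = b \<and> a' \<bullet> v = b' \<and> a$1 * a'$2 \<noteq> a$2 * a'$1"
proof (rule ccontr)
  assume neg: "\<not> ?thesis"
  have vf: "v \<in> frontier S" using v by (simp add: region_vertices_def)
  have fS: "x \<in> S \<and> x \<notin> interior S \<longleftrightarrow> x \<in> frontier S" for x
    using \<open>closed S\<close> by (auto simp: frontier_def)
  have "\<forall>\<^sub>F x in nhds v. \<forall>h\<in>H. fst h \<bullet> v \<noteq> snd h \<longrightarrow> (fst h \<bullet> x \<le> snd h \<longleftrightarrow> fst h \<bullet> v \<le> snd h)"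
    using fin by (intro eventually_ball_finite ballI) (auto intro: eventually_same_side)
  then obtain e where e: "e > 0"
    and inactive: "\<And>x a b. \<lbrakk>dist x v < e; (a, b) \<in> H; a \<bullet> v \<noteq> b\<rbrakk> \<Longrightarrow> a \<bullet> x \<le> b \<longleftrightarrow> a \<bullet> v \<le> b"
    unfolding eventually_nhds_metric by fastforce
  have not_ball: "\<not> ball v e \<subseteq> S"
    using vf fS e by (meson centre_in_ball interior_maximal open_ball subsetD)
  show False
  proof (cases "\<exists>a b. (a, b) \<in> H \<and> a \<bullet> v = b")
    case False
    have "ball v e \<subseteq> S"
    proof
      fix x assume "x \<in> ball v e"
      then show "x \<in> S"
        using False inactive[of x] vf fS by (intro det[of v x]) (auto simp: dist_commute)
    qed
    then show False using not_ball by blast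
  next
    case True
    then obtain a b where ab: "(a, b) \<in> H" "a \<bullet> v = b" by blast
    \<comment> \<open>The constraints tight at \<open>v\<close> have normals that are multiples of
      \<open>a\<close>, possibly negative, so the sign of \<open>a \<bullet> x - b\<close> settles
      them all. The sign 0 is a separate case, since closed half-planes on both sides contain the
      line.\<close>
    have same: "y \<in> S" if "x \<in> S" "x \<in> ball v e" "y \<in> ball v e" "sgn (a \<bullet> x - b) = sgn (a \<bullet> y - b)" for x y
    proof (rule det[of x y])
      fix a' b' assume h: "(a', b') \<in> H"
      show "a' \<bullet> x \<le> b' \<longleftrightarrow> a' \<bullet> y \<le> b'"
      proof (cases "a' \<bullet> v = b'")
        case True
        then have "a$1 * a'$2 = a$2 * a'$1" using neg ab h by blast
        then obtain c where c: "c \<noteq> 0" "a' = c *\<^sub>R a"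
          using parallel_imp_scaled nz ab h by blast
        then have b': "b' = c * b" using True ab by simp
        have "a' \<bullet> z \<le> b' \<longleftrightarrow> sgn c * sgn (a \<bullet> z - b) \<le> 0" for z
        proof -
          have "a' \<bullet> z \<le> b' \<longleftrightarrow> c * (a \<bullet> z - b) \<le> 0" unfolding b' c(2) by (simp add: algebra_simps)
          also have "\<dots> \<longleftrightarrow> sgn (c * (a \<bullet> z - b)) \<le> 0" by (rule sgn_le_0_iff[symmetric])
          finally show ?thesis by (simp add: sgn_mult)
        qed
        then show ?thesis using that(4) by simp
      next
        case False
        then show ?thesis using inactive[OF _ h, of x] inactive[OF _ h, of y] that by (simp add: dist_commute)
      qed
    qed fact
    have "frontier S \<inter> ball v e = {x. a \<bullet> x = b} \<inter> ball v e"
    proof (intro set_eqI iffI)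
      fix x assume x: "x \<in> frontier S \<inter> ball v e"
      have "a \<bullet> x = b"
      proof (rule ccontr)
        assume ne: "a \<bullet> x \<noteq> b"
        define U where "U = ball v e \<inter> (if a \<bullet> x < b then {y. a \<bullet> y < b} else {y. a \<bullet> y > b})"
        have "open U" unfolding U_def by (simp add: open_Int open_halfspace_lt open_halfspace_gt)
        moreover have "U \<subseteq> S"
        proof
          fix y assume y: "y \<in> U"
          show "y \<in> S"
            by (rule same[of x y]) (use y x ne fS in \<open>auto simp: U_def split: if_splits\<close>)
        qed
        moreover have "x \<in> U" using x ne by (auto simp: U_def)
        ultimately have "x \<in> interior S" by (meson interior_maximal subsetD)
        then show False using x fS by blast
      qed
      then show "x \<in> {x. a \<bullet> x = b} \<inter> ball v e" using x by simp
    next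
      fix x assume x: "x \<in> {x. a \<bullet> x = b} \<inter> ball v e"
      have "x \<in> S" by (rule same[of v x]) (use vf fS x ab e in auto)
      \<comment> \<open>An interior point on the line would bring points of both open sides into
        \<open>S\<close>. Together with \<open>v\<close> they represent all three signs, so the
        whole ball would be in \<open>S\<close>, although \<open>v\<close> is a boundary
        point.\<close>
      moreover have "x \<notin> interior S"
      proof
        assume "x \<in> interior S"
        then have "x \<in> interior S \<inter> ball v e" "open (interior S \<inter> ball v e)" using x by auto
        then obtain d where d: "d > 0" "ball x d \<subseteq> interior S \<inter> ball v e"
          by (meson open_contains_ball)
        have "a \<noteq> 0" using nz ab by blast
        define s where "s = d / (2 * norm a)"
        have s: "s > 0" using d \<open>a \<noteq> 0\<close> by (simp add: s_def)
        have "norm (s *\<^sub>R a) < d" using d \<open>a \<noteq> 0\<close> by (simp add: s_def)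
        then have "x + s *\<^sub>R a \<in> ball x d" "x - s *\<^sub>R a \<in> ball x d"
          by (simp_all add: dist_norm)
        then have pm: "x + s *\<^sub>R a \<in> S" "x - s *\<^sub>R a \<in> S" "x + s *\<^sub>R a \<in> ball v e" "x - s *\<^sub>R a \<in> ball v e"
          using d(2) interior_subset by blast+
        have pos: "s * (a \<bullet> a) > 0" using s \<open>a \<noteq> 0\<close> by simp
        have val: "a \<bullet> (x + s *\<^sub>R a) - b = s * (a \<bullet> a)" "a \<bullet> (x - s *\<^sub>R a) - b = - (s * (a \<bullet> a))"
          using x by (simp_all add: inner_add_right inner_diff_right)
        have "ball v e \<subseteq> S"
        proof
          fix y assume y: "y \<in> ball v e"
          consider "a \<bullet> y - b = 0" | "a \<bullet> y - b > 0" | "a \<bullet> y - b < 0" by linarith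
          then show "y \<in> S"
          proof cases
            case 1
            then show ?thesis using same[of v y] y e vf fS[of v] ab by simp
          next
            case 2
            then show ?thesis using same[OF pm(1,3) y] pos unfolding val by simp
          next
            case 3
            then show ?thesis using same[OF pm(2,4) y] pos unfolding val by simp
          qed
        qed
        then show False using not_ball by blast
      qed
      ultimately show "x \<in> frontier S \<inter> ball v e" using fS x by blast
    qed
    moreover obtain w where "w \<noteq> v" "{x. a \<bullet> x = b} = affine hull {v, w}"
      using line_eq_affine_hull[OF nz[OF ab(1)] ab(2)] by blast
    ultimately show False using v e unfolding region_vertices_def by auto
  qed
qed

text \<open>Finitely many half-planes describe all triangles of the region, and every vertex is a
  crossing of two non-parallel boundary lines among them.\<close>

lemma finite_region_vertices:
  assumes "polygonal_region S"
  shows "finite (region_vertices S)"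
proof -
  obtain \<T> where \<T>: "finite \<T>" "\<And>T. T \<in> \<T> \<Longrightarrow> 2 simplex T" "S = \<Union>\<T>"
    using assms unfolding polygonal_region_def by blast
  have "\<exists>H. finite H \<and> (\<forall>(a, b)\<in>H. a \<noteq> 0) \<and> T = {x. \<forall>(a, b)\<in>H. a \<bullet> x \<le> b}" if T: "T \<in> \<T>" for T
  proof -
    obtain F where F: "finite F" "T = \<Inter>F" "\<forall>h\<in>F. \<exists>a b. a \<noteq> 0 \<and> h = {x. a \<bullet> x \<le> b}"
      using simplex_imp_polyhedron[OF \<T>(2)[OF T]] unfolding polyhedron_def by blast
    then obtain A B where AB: "\<And>h. h \<in> F \<Longrightarrow> A h \<noteq> 0 \<and> h = {x. A h \<bullet> x \<le> B h}" by metis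
    have "x \<in> h \<longleftrightarrow> A h \<bullet> x \<le> B h" if "h \<in> F" for x h using AB[OF that] by blast
    then have "T = {x. \<forall>(a, b)\<in>(\<lambda>h. (A h, B h)) ` F. a \<bullet> x \<le> b}"
      unfolding F(2) by auto
    then show ?thesis using F(1) AB by (intro exI[of _ "(\<lambda>h. (A h, B h)) ` F"]) auto
  qed
  then have "\<forall>T\<in>\<T>. \<exists>H. finite H \<and> (\<forall>(a, b)\<in>H. a \<noteq> 0) \<and> T = {x. \<forall>(a, b)\<in>H. a \<bullet> x \<le> b}"
    by (rule ballI)
  from bchoice[OF this] obtain H where H: "\<forall>T\<in>\<T>. finite (H T) \<and> (\<forall>(a, b)\<in>H T. a \<noteq> 0) \<and>
      T = {x. \<forall>(a, b)\<in>H T. a \<bullet> x \<le> b}"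
    by (elim exE)
  have mem: "x \<in> T \<longleftrightarrow> (\<forall>(a, b)\<in>H T. a \<bullet> x \<le> b)" if "T \<in> \<T>" for x T
  proof -
    have "T = {x. \<forall>(a, b)\<in>H T. a \<bullet> x \<le> b}" using bspec[OF H that] by (elim conjE)
    from arg_cong[OF this, of "\<lambda>A. x \<in> A"] show ?thesis by (simp only: mem_Collect_eq)
  qed
  have Hfin: "finite (H T)" if "T \<in> \<T>" for T
    using bspec[OF H that] by (rule conjunct1)
  have Hnz: "\<forall>(a, b)\<in>H T. a \<noteq> 0" if "T \<in> \<T>" for T
    using bspec[OF H that] by (elim conjE)
  define H' where "H' = \<Union>(H ` \<T>)"
  have fin: "finite H'" using \<T>(1) Hfin by (simp add: H'_def)
  have "closed S" unfolding \<T>(3)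
    using \<T> by (intro closed_Union) (auto intro: polyhedron_imp_closed simplex_imp_polyhedron)
  \<comment> \<open>The common point of two boundary lines, or the empty set if they are
    parallel.\<close>
  define X where "X = (\<lambda>((a, b), (a', b')). {v::real^2. a \<bullet> v = b \<and> a' \<bullet> v = b' \<and> a$1 * a'$2 \<noteq> a$2 * a'$1})"
  have sub: "region_vertices S \<subseteq> \<Union>(X ` (H' \<times> H'))"
  proof
    fix v assume v: "v \<in> region_vertices S"
    have "\<exists>a b a' b'. (a, b) \<in> H' \<and> (a', b') \<in> H' \<and> a \<bullet> v = b \<and> a' \<bullet> v = b' \<and> a$1 * a'$2 \<noteq> a$2 * a'$1"
    proof (rule region_vertices_subset_crossings[OF fin _ \<open>closed S\<close> _ v])
      show "a \<noteq> 0" if "(a, b) \<in> H'" for a b using that Hnz unfolding H'_def by blast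
      show "y \<in> S" if *: "\<And>a b. (a, b) \<in> H' \<Longrightarrow> a \<bullet> x \<le> b \<longleftrightarrow> a \<bullet> y \<le> b" and "x \<in> S" for x y
      proof -
        obtain T where T: "T \<in> \<T>" "x \<in> T" using \<open>x \<in> S\<close> \<T>(3) by blast
        then have "y \<in> T" using mem[OF T(1)] * by (fastforce simp: H'_def)
        then show "y \<in> S" using T \<T>(3) by blast
      qed
    qed
    then show "v \<in> \<Union>(X ` (H' \<times> H'))" by (force simp: X_def)
  qed
  have finX: "finite (X z)" for z
  proof -
    obtain a b a' b' where z: "z = ((a, b), (a', b'))" by (metis surj_pair)
    have "v = v'" if "v \<in> X z" "v' \<in> X z" for v v'
    proof -
      let ?D = "a$1 * a'$2 - a$2 * a'$1"
      have D: "?D \<noteq> 0" and "a$1 * v$1 + a$2 * v$2 = a$1 * v'$1 + a$2 * v'$2"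
        and "a'$1 * v$1 + a'$2 * v$2 = a'$1 * v'$1 + a'$2 * v'$2"
        using that unfolding X_def z by (auto simp: inner_vec2)
      then have "?D * v$1 = ?D * v'$1" "?D * v$2 = ?D * v'$2" by algebra+
      then show ?thesis using D by (simp add: vec2_eq_iff)
    qed
    then have "\<exists>v. X z \<subseteq> {v}" by blast
    then show ?thesis using finite_subset by blast
  qed
  have "finite (\<Union>(X ` (H' \<times> H')))" using fin finX by (intro finite_UN_I finite_cartesian_product)
  then show ?thesis by (rule finite_subset[OF sub])
qed

text \<open>Normal and offset of the line \<open>x y\<close>. The normal points to the right of the
  direction from \<open>x\<close> to \<open>y\<close>, so the closed half-plane it bounds is the
  left side.\<close>

definition side :: "real^2 \<Rightarrow> real^2 \<Rightarrow> (real^2) \<times> real" where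
  "side x y = (vector [y$2 - x$2, x$1 - y$1], (y$2 - x$2) * x$1 + (x$1 - y$1) * x$2)"

lemma side_inner: "fst (side x y) \<bullet> z - snd (side x y) = - orient x y z"
  by (simp add: side_def inner_vec2 orient_def algebra_simps)

lemma side_nonzero: "x \<noteq> y \<Longrightarrow> fst (side x y) \<noteq> 0"
  by (auto simp: side_def vec2_eq_iff)

text \<open>A vertex lies on two of the three side lines, so two of its barycentric coordinates
  vanish and it is a corner.\<close>

lemma region_vertices_triangle:
  assumes "orient x y z \<noteq> 0"
  shows "region_vertices (convex hull {x, y, z}) \<subseteq> {x, y, z}"
proof -
  have pos: "region_vertices (convex hull {x, y, z}) \<subseteq> {x, y, z}" if o: "orient x y z > 0" for x y z
  proof
    let ?T = "convex hull {x, y, z}"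
    let ?H = "{side x y, side y z, side z x}"
    fix v assume v: "v \<in> region_vertices ?T"
    have "x \<noteq> y" "y \<noteq> z" "z \<noteq> x" using o by auto
    have le: "fst (side p q) \<bullet> w \<le> snd (side p q) \<longleftrightarrow> orient p q w \<ge> 0" for p q w
      using side_inner[of p q w] by linarith
    have "\<exists>a b a' b'. (a, b) \<in> ?H \<and> (a', b') \<in> ?H \<and> a \<bullet> v = b \<and> a' \<bullet> v = b' \<and> a$1 * a'$2 \<noteq> a$2 * a'$1"
    proof (rule region_vertices_subset_crossings[OF _ _ _ _ v])
      show "a \<noteq> 0" if "(a, b) \<in> ?H" for a b
        using that \<open>x \<noteq> y\<close> \<open>y \<noteq> z\<close> \<open>z \<noteq> x\<close> side_nonzero by (metis fst_conv insert_iff singletonD)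
      show "closed ?T" by (simp add: compact_imp_closed finite_imp_compact_convex_hull)
      show "w' \<in> ?T" if *: "\<And>a b. (a, b) \<in> ?H \<Longrightarrow> a \<bullet> w \<le> b \<longleftrightarrow> a \<bullet> w' \<le> b" and w: "w \<in> ?T" for w w'
      proof -
        have "orient p q w \<ge> 0 \<longleftrightarrow> orient p q w' \<ge> 0" if "side p q \<in> ?H" for p q
          using *[of "fst (side p q)" "snd (side p q)"] that unfolding le by simp
        then show ?thesis using w unfolding triangle_iff[OF o] by simp
      qed
    qed simp
    then obtain h h' where h: "h \<in> ?H" "h' \<in> ?H" "fst h \<bullet> v = snd h" "fst h' \<bullet> v = snd h'" "h \<noteq> h'"
      by (metis fst_conv snd_conv mult.commute)
    have on: "fst (side p q) \<bullet> v = snd (side p q) \<longleftrightarrow> orient p q v = 0" for p q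
      using side_inner[of p q v] by linarith
    have "orient x y v = 0 \<and> orient y z v = 0 \<or> orient y z v = 0 \<and> orient z x v = 0 \<or>
        orient x y v = 0 \<and> orient z x v = 0"
      using h on by auto
    moreover have "orient x y z *\<^sub>R v = orient y z v *\<^sub>R x + orient z x v *\<^sub>R y + orient x y v *\<^sub>R z"
      "orient y z v + orient z x v + orient x y v = orient x y z"
      by (rule orient_barycentric, rule orient_barycentric_sum)
    ultimately show "v \<in> {x, y, z}" using o by auto
  qed
  show ?thesis
  proof (cases "orient x y z > 0")
    case True
    then show ?thesis by (rule pos)
  next
    case False
    then have "orient y x z > 0" using assms orient_swap[of y x z] by simp
    then show ?thesis using pos[of y x z] by (simp add: insert_commute)
  qed
qed

section \<open>Deleting an edge\<close>

lemma general_position_mono: "\<lbrakk>general_position Y; X \<subseteq> Y\<rbrakk> \<Longrightarrow> general_position X"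
  unfolding general_position_def by blast

lemma general_position_orient:
  "\<lbrakk>general_position X; x \<in> X; y \<in> X; z \<in> X; x \<noteq> y; y \<noteq> z; x \<noteq> z\<rbrakk> \<Longrightarrow> orient x y z \<noteq> 0"
  unfolding general_position_def collinear_iff_orient by blast

lemma negligible_orient_zero:
  assumes "y \<noteq> z"
  shows "negligible {x. orient y z x = 0}"
proof -
  have "{x. orient y z x = 0} = {x. fst (side y z) \<bullet> x = snd (side y z)}"
    using side_inner[of y z] by (metis eq_iff_diff_eq_0 neg_equal_0_iff_equal)
  then show ?thesis using negligible_hyperplane side_nonzero[OF assms] by metis
qed

text \<open>The lines through pairs of points of \<open>X\<close> are finitely many null sets, which
  cannot cover a non-empty open set.\<close>

lemma exists_generic_point:
  assumes fin: "finite X" and gp: "general_position X" and U: "open U" "U \<noteq> {}"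
  shows "\<exists>x\<in>U. x \<notin> X \<and> general_position (insert x X)"
proof -
  define P where "P = {(y, z). y \<in> X \<and> z \<in> X \<and> y \<noteq> z}"
  define Bad where "Bad = X \<union> \<Union>((\<lambda>(y, z). {x. orient y z x = 0}) ` P)"
  have "finite P" by (rule finite_subset[of _ "X \<times> X"]) (auto simp: P_def fin)
  then have "negligible (\<Union>((\<lambda>(y, z). {x. orient y z x = 0}) ` P))"
    by (intro negligible_Union finite_imageI) (auto simp: P_def intro: negligible_orient_zero)
  then have "negligible Bad"
    unfolding Bad_def using negligible_finite[OF fin] by (rule negligible_Un[rotated])
  then obtain x where x: "x \<in> U" "x \<notin> Bad"
    using open_not_negligible[OF U] negligible_subset by blast
  then have "x \<notin> X" and o: "\<And>y z. \<lbrakk>y \<in> X; z \<in> X; y \<noteq> z\<rbrakk> \<Longrightarrow> orient y z x \<noteq> 0"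
    by (auto simp: Bad_def P_def)
  moreover have "orient a b c \<noteq> 0"
    if *: "a \<in> insert x X" "b \<in> insert x X" "c \<in> insert x X" "a \<noteq> b" "b \<noteq> c" "a \<noteq> c" for a b c
  proof -
    consider "a = x" | "b = x" | "c = x" | "a \<in> X" "b \<in> X" "c \<in> X" using * by blast
    then show ?thesis
    proof cases
      case 1
      then have "orient b c a \<noteq> 0" using o * by blast
      then show ?thesis using orient_rotate[of b c a] by simp
    next
      case 2
      then have "orient c a b \<noteq> 0" using o * by blast
      then show ?thesis using orient_rotate[of c a b] orient_rotate[of b c a] by simp
    next
      case 3
      then show ?thesis using o * by blast
    next
      case 4
      then show ?thesis using general_position_orient[OF gp] * by blast
    qed
  qed
  then have "general_position (insert x X)"
    unfolding general_position_def collinear_iff_orient by blast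
  ultimately show ?thesis using x by blast
qed

lemma finite_segment_Int_line:
  assumes "orient u v a \<noteq> 0 \<or> orient u v b \<noteq> 0"
  shows "finite (closed_segment a b \<inter> {x. orient u v x = 0})"
proof -
  have "x = y" if x: "x \<in> closed_segment a b" "orient u v x = 0" and y: "y \<in> closed_segment a b" "orient u v y = 0" for x y
  proof -
    obtain s where s: "x = (1 - s) *\<^sub>R a + s *\<^sub>R b" using x by (auto simp: in_segment)
    obtain t where t: "y = (1 - t) *\<^sub>R a + t *\<^sub>R b" using y by (auto simp: in_segment)
    have 1: "(1 - s) * orient u v a + s * orient u v b = 0"
      using x(2) unfolding s by (simp add: orient_affine)
    have 2: "(1 - t) * orient u v a + t * orient u v b = 0"
      using y(2) unfolding t by (simp add: orient_affine)
    have "(s - t) * orient u v a = 0" "(s - t) * orient u v b = 0" using 1 2 by algebra+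
    then have "s = t" using assms by auto
    then show ?thesis using s t by simp
  qed
  then have "\<exists>x. closed_segment a b \<inter> {x. orient u v x = 0} \<subseteq> {x}" by blast
  then show ?thesis using finite_subset by blast
qed

text \<open>Ensures that a triangle crossing the line \<open>u v\<close> close to \<open>m\<close>
  crosses it between the endpoints.\<close>

lemma in_segment_if_near:
  assumes m: "m \<in> open_segment u v" and q: "orient u v q = 0"
    and near: "dist m q < dist m u" "dist m q < dist m v"
  shows "q \<in> closed_segment u v"
proof -
  have "u \<noteq> v" using m by auto
  obtain \<mu> where \<mu>: "m = (1 - \<mu>) *\<^sub>R u + \<mu> *\<^sub>R v" "0 < \<mu>" "\<mu> < 1"
    using m by (auto simp: in_segment)
  have "collinear {u, q, v}" using q collinear_iff_orient[of u v q] by (simp add: insert_commute)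
  then obtain s where s: "q = s *\<^sub>R u + (1 - s) *\<^sub>R v" using \<open>u \<noteq> v\<close> by (auto simp: collinear_3_expand)
  let ?d = "norm (v - u)"
  have "m - q = (\<mu> - (1 - s)) *\<^sub>R (v - u)" "m - u = \<mu> *\<^sub>R (v - u)" "m - v = - ((1 - \<mu>) *\<^sub>R (v - u))"
    unfolding s \<mu>(1) by (simp_all add: algebra_simps)
  then have "\<bar>\<mu> - (1 - s)\<bar> * ?d < \<mu> * ?d" "\<bar>\<mu> - (1 - s)\<bar> * ?d < (1 - \<mu>) * ?d"
    using near \<mu> by (simp_all add: dist_norm)
  then have "\<bar>\<mu> - (1 - s)\<bar> < \<mu>" "\<bar>\<mu> - (1 - s)\<bar> < 1 - \<mu>"
    by (simp_all add: mult_less_cancel_right)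
  then have "0 \<le> 1 - s" "1 - s \<le> 1" by linarith+
  then show ?thesis unfolding in_segment s by (intro exI[of _ "1 - s"]) simp
qed

lemma triangle_polygonal_obstacle:
  assumes "orient x y z \<noteq> 0"
  shows "polygonal_obstacle (convex hull {x, y, z})"
proof -
  have "x \<noteq> y" "y \<noteq> z" "x \<noteq> z" using assms by auto
  moreover have "\<not> affine_dependent {x, y, z}"
    using assms collinear_3_eq_affine_dependent[of x y z] by (auto simp: collinear_iff_orient)
  ultimately have "2 simplex (convex hull {x, y, z})"
    unfolding simplex_def by (intro exI[of _ "{x, y, z}"]) simp
  then have "polygonal_region (convex hull {x, y, z})"
    unfolding polygonal_region_def by (intro exI[of _ "{convex hull {x, y, z}}"]) simp
  then show ?thesis by (simp add: polygonal_obstacle_def convex_connected)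
qed

text \<open>Recording non-edges turns edge deletion into \<open>insert\<close>, with the complete
  graph at \<open>F = {}\<close>. Members of \<open>F\<close> that are not pairs of distinct
  vertices delete nothing.\<close>

definition complete_minus :: "'a set \<Rightarrow> 'a set set \<Rightarrow> 'a pair_pre_digraph" where
  "complete_minus V F = \<lparr>pverts = V, parcs = {(u, v). u \<in> V \<and> v \<in> V \<and> u \<noteq> v \<and> {u, v} \<notin> F}\<rparr>"

lemma pair_graph_complete_minus:
  assumes "finite V"
  shows "pair_graph (complete_minus V F)"
proof
  show "finite (parcs (complete_minus V F))"
    by (rule finite_subset[of _ "V \<times> V"]) (auto simp: complete_minus_def assms)
qed (auto simp: complete_minus_def assms symmetric_def sym_def insert_commute)

text \<open>By general position every other segment meets the line through \<open>p u\<close> and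
  \<open>p v\<close> in at most one point, so some \<open>m\<close> inside the segment is off all of
  them, and a small triangle around there blocks this segment only.\<close>

lemma block_edge:
  assumes fin: "finite V" and rep: "obstacle_representation (complete_minus V F) p \<O>"
    and uv: "u \<in> V" "v \<in> V" "u \<noteq> v"
  shows "\<exists>T. obstacle_representation (complete_minus V (insert {u, v} F)) p (insert T \<O>)"
proof -
  define X where "X = p ` V \<union> (\<Union>S\<in>\<O>. region_vertices S)"
  have inj: "inj_on p V" and finO: "finite \<O>" and poly: "\<And>S. S \<in> \<O> \<Longrightarrow> polygonal_obstacle S"
    and gp: "general_position X"
    and adj: "\<And>a b. \<lbrakk>a \<in> V; b \<in> V; a \<noteq> b\<rbrakk> \<Longrightarrow> {a, b} \<notin> F \<longleftrightarrow> (\<forall>S\<in>\<O>. closed_segment (p a) (p b) \<inter> S = {})"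
    using rep by (auto simp: obstacle_representation_def complete_minus_def X_def)
  have finX: "finite X"
    using fin finO poly finite_region_vertices by (auto simp: X_def polygonal_obstacle_def)
  have pX: "p a \<in> X" if "a \<in> V" for a using that by (simp add: X_def)
  have pne: "p a \<noteq> p b" if "a \<in> V" "b \<in> V" "a \<noteq> b" for a b using inj that by (auto dest: inj_onD)
  \<comment> \<open>Edges and non-edges alike: the new triangle avoids every other segment, so no
    other pair changes its status.\<close>
  define A where "A = {(a, b). a \<in> V \<and> b \<in> V \<and> a \<noteq> b \<and> {a, b} \<noteq> {u, v}}"
  define K where "K = (\<Union>(a, b)\<in>A. closed_segment (p a) (p b))"
  have "finite A" by (rule finite_subset[of _ "V \<times> V"]) (auto simp: A_def fin)
  then have "closed K" unfolding K_def by (intro closed_UN) auto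
  have finK: "finite (K \<inter> {x. orient (p u) (p v) x = 0})"
  proof -
    have "finite (closed_segment (p a) (p b) \<inter> {x. orient (p u) (p v) x = 0})" if ab: "(a, b) \<in> A" for a b
    proof (rule finite_segment_Int_line)
      have "(a \<noteq> u \<and> a \<noteq> v) \<or> (b \<noteq> u \<and> b \<noteq> v)" using ab by (auto simp: A_def)
      then show "orient (p u) (p v) (p a) \<noteq> 0 \<or> orient (p u) (p v) (p b) \<noteq> 0"
        using general_position_orient[OF gp, of "p u" "p v"] pX pne uv ab unfolding A_def by blast
    qed
    then have "finite (\<Union>(a, b)\<in>A. closed_segment (p a) (p b) \<inter> {x. orient (p u) (p v) x = 0})"
      using \<open>finite A\<close> by auto
    moreover have "K \<inter> {x. orient (p u) (p v) x = 0} \<subseteq>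
        (\<Union>(a, b)\<in>A. closed_segment (p a) (p b) \<inter> {x. orient (p u) (p v) x = 0})"
      unfolding K_def by blast
    ultimately show ?thesis by (rule rev_finite_subset)
  qed
  have on_line: "orient (p u) (p v) x = 0" if x: "x \<in> open_segment (p u) (p v)" for x
  proof -
    obtain s where s: "x = (1 - s) *\<^sub>R p u + s *\<^sub>R p v" using x by (auto simp: in_segment)
    show ?thesis unfolding s by (simp add: orient_affine)
  qed
  have "infinite (open_segment (p u) (p v))" using pne uv by simp
  then have "\<not> open_segment (p u) (p v) \<subseteq> K \<inter> {x. orient (p u) (p v) x = 0}"
    using finite_subset[OF _ finK] by blast
  then obtain m where m: "m \<in> open_segment (p u) (p v)" "m \<notin> K"
    using on_line by auto
  obtain e where e: "e > 0" "ball m e \<subseteq> - K"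
    using \<open>closed K\<close> m(2) open_contains_ball[of "- K"] by auto
  have "m \<noteq> p u" "m \<noteq> p v" using m(1) by (auto simp: open_segment_def)
  \<comment> \<open>Within this radius no other segment is met, and the line through
    \<open>p u\<close> and \<open>p v\<close> does not reach past either endpoint.\<close>
  define r where "r = min e (min (dist m (p u)) (dist m (p v)))"
  have r: "r > 0" "r \<le> e" "r \<le> dist m (p u)" "r \<le> dist m (p v)"
    using e \<open>m \<noteq> p u\<close> \<open>m \<noteq> p v\<close> by (auto simp: r_def)
  let ?l = "orient (p u) (p v)"
  obtain x where x: "x \<in> ball m r" "x \<notin> X" "general_position (insert x X)"
    using exists_generic_point[OF finX gp, of "ball m r"] r(1) by auto
  have lx: "?l x \<noteq> 0"
    using x(2) pX[OF uv(1)] pX[OF uv(2)] pne[OF uv] by (intro general_position_orient[OF x(3)]) auto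
  define U where "U = ball m r \<inter> {y. ?l y * ?l x < 0}"
  have "open U" unfolding U_def by (intro open_Int open_Collect_less continuous_intros) simp
  \<comment> \<open>The mirror image of \<open>x\<close> in \<open>m\<close> shows that the opposite
    half of the ball is non-empty.\<close>
  moreover have "2 *\<^sub>R m - x \<in> U"
  proof -
    have "?l (2 *\<^sub>R m - x) = 2 * ?l m - ?l x" by (simp add: orient_def algebra_simps)
    then have "?l (2 *\<^sub>R m - x) * ?l x < 0" using on_line[OF m(1)] lx by (auto simp: zero_less_mult_iff neq_iff)
    moreover have "dist m (2 *\<^sub>R m - x) = dist m x"
      by (simp add: dist_norm scaleR_2 algebra_simps norm_minus_commute)
    ultimately show ?thesis using x(1) by (simp add: U_def)
  qed
  ultimately obtain y where y: "y \<in> U" "y \<notin> insert x X" "general_position (insert y (insert x X))"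
    using exists_generic_point[of "insert x X" U] finX x(3) by auto
  obtain z where z: "z \<in> ball m r" "z \<notin> insert y (insert x X)"
    "general_position (insert z (insert y (insert x X)))"
    using exists_generic_point[of "insert y (insert x X)" "ball m r"] finX y(3) r(1) by auto
  define T where "T = convex hull {x, y, z}"
  have oxyz: "orient x y z \<noteq> 0"
    by (rule general_position_orient[OF z(3)]) (use y z in auto)
  have "{x, y, z} \<subseteq> ball m r" using x y z by (auto simp: U_def)
  then have T: "T \<subseteq> ball m r" unfolding T_def by (rule hull_minimal) simp
  have TK: "closed_segment (p a) (p b) \<inter> T = {}" if "a \<in> V" "b \<in> V" "a \<noteq> b" "{a, b} \<noteq> {u, v}" for a b
  proof -
    have "closed_segment (p a) (p b) \<subseteq> K" using that unfolding K_def A_def by blast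
    moreover have "T \<subseteq> - K" using T e(2) r(2) by (meson order_trans subset_ball)
    ultimately show ?thesis by blast
  qed
  have Tuv: "closed_segment (p u) (p v) \<inter> T \<noteq> {}"
  proof -
    have sgn: "?l y * ?l x < 0" using y by (simp add: U_def)
    define s where "s = ?l x / (?l x - ?l y)"
    have ne: "?l x - ?l y \<noteq> 0" using sgn by (auto simp: mult_less_0_iff)
    have s: "0 \<le> s" "s \<le> 1"
      using sgn by (auto simp: s_def mult_less_0_iff divide_simps)
    define q where "q = (1 - s) *\<^sub>R x + s *\<^sub>R y"
    have "?l q = (1 - s) * ?l x + s * ?l y" unfolding q_def by (simp add: orient_affine)
    also have "\<dots> = 0" using ne by (simp add: s_def field_simps)
    finally have "?l q = 0" .
    have "q \<in> closed_segment x y" using s by (auto simp: q_def in_segment)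
    moreover have "closed_segment x y \<subseteq> T"
      unfolding T_def segment_convex_hull by (rule hull_mono) blast
    ultimately have "q \<in> T" by blast
    then have "dist m q < r" using T by auto
    then have "q \<in> closed_segment (p u) (p v)"
      using in_segment_if_near[OF m(1) \<open>?l q = 0\<close>] r by linarith
    then show ?thesis using \<open>q \<in> T\<close> by blast
  qed
  have "region_vertices T \<subseteq> {x, y, z}" unfolding T_def by (rule region_vertices_triangle[OF oxyz])
  then have "general_position (p ` V \<union> (\<Union>S\<in>insert T \<O>. region_vertices S))"
    by (intro general_position_mono[OF z(3)]) (auto simp: X_def)
  moreover have "polygonal_obstacle T" unfolding T_def by (rule triangle_polygonal_obstacle[OF oxyz])
  moreover have "({a, b} \<notin> insert {u, v} F) \<longleftrightarrow> (\<forall>S\<in>insert T \<O>. closed_segment (p a) (p b) \<inter> S = {})"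
    if "a \<in> V" "b \<in> V" "a \<noteq> b" for a b
  proof (cases "{a, b} = {u, v}")
    case True
    then have "closed_segment (p a) (p b) \<inter> T \<noteq> {}"
      using Tuv by (auto simp: doubleton_eq_iff closed_segment_commute)
    then show ?thesis using True by simp
  next
    case False
    then show ?thesis using adj[OF that] TK[OF that] by simp
  qed
  ultimately have "obstacle_representation (complete_minus V (insert {u, v} F)) p (insert T \<O>)"
    using inj finO poly unfolding obstacle_representation_def complete_minus_def by simp
  then show ?thesis by blast
qed

section \<open>Intermediate values of the obstacle number\<close>

lemma obs_le: "obstacle_representation G p \<O> \<Longrightarrow> obs G \<le> enat (card \<O>)"
  unfolding obs_def by (rule INF_lower) blast

lemma obs_attained:
  assumes "obs G \<noteq> \<infinity>"
  shows "\<exists>p \<O>. obstacle_representation G p \<O> \<and> obs G = enat (card \<O>)"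
proof -
  let ?A = "(\<lambda>\<O>. enat (card \<O>)) ` {\<O>. \<exists>p. obstacle_representation G p \<O>}"
  have obs: "obs G = (if ?A = {} then \<infinity> else (LEAST x. x \<in> ?A))"
    unfolding obs_def Inf_enat_def ..
  then have "?A \<noteq> {}" using assms by metis
  then obtain x where "x \<in> ?A" by blast
  then have "(LEAST x. x \<in> ?A) \<in> ?A" by (rule LeastI)
  then have "obs G \<in> ?A" using obs \<open>?A \<noteq> {}\<close> by metis
  then show ?thesis by auto
qed

lemma obs_delete_edge:
  assumes "finite V"
  shows "obs (complete_minus V (insert e F)) \<le> obs (complete_minus V F) + 1"
proof (cases "obs (complete_minus V F) = \<infinity> \<or> \<not> (\<exists>u\<in>V. \<exists>v\<in>V. u \<noteq> v \<and> e = {u, v})")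
  case True
  then show ?thesis
  proof
    assume "\<not> (\<exists>u\<in>V. \<exists>v\<in>V. u \<noteq> v \<and> e = {u, v})"
    then have "complete_minus V (insert e F) = complete_minus V F"
      unfolding complete_minus_def by auto
    then show ?thesis by simp
  qed simp
next
  case False
  then obtain u v where uv: "u \<in> V" "v \<in> V" "u \<noteq> v" "e = {u, v}" by blast
  obtain p \<O> where rep: "obstacle_representation (complete_minus V F) p \<O>"
    and card: "obs (complete_minus V F) = enat (card \<O>)"
    using obs_attained False by blast
  obtain T where "obstacle_representation (complete_minus V (insert e F)) p (insert T \<O>)"
    using block_edge[OF assms rep uv(1-3)] uv(4) by blast
  then have "obs (complete_minus V (insert e F)) \<le> enat (card (insert T \<O>))" by (rule obs_le)
  also have "\<dots> \<le> enat (card \<O> + 1)" by (simp add: card_insert_le_m1)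
  finally show ?thesis using card by (simp add: one_enat_def)
qed

text \<open>The points lie on a parabola, where the orientation of three points is a Vandermonde
  determinant; the empty family of obstacles then serves.\<close>

lemma obs_complete: "obs (complete_minus (V :: nat set) {}) = 0"
proof -
  define p :: "nat \<Rightarrow> real^2" where "p i = vector [real i, (real i)\<^sup>2]" for i
  have p: "p i $ 1 = real i" "p i $ 2 = (real i)\<^sup>2" for i by (simp_all add: p_def)
  have "orient (p i) (p j) (p k) = (real j - real i) * (real k - real i) * (real k - real j)" for i j k
    by (simp add: orient_def p power2_eq_square algebra_simps)
  then have "general_position (p ` V)"
    unfolding general_position_def collinear_iff_orient by auto
  moreover have "inj_on p V" by (auto simp: inj_on_def vec2_eq_iff p)
  ultimately have "obstacle_representation (complete_minus V {}) p {}"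
    by (simp add: obstacle_representation_def complete_minus_def)
  from obs_le[OF this] show ?thesis by (simp flip: zero_enat_def)
qed

text \<open>A discrete intermediate value argument: if the value is below \<open>h\<close> before a
  deletion and at least \<open>h\<close> after it, a rise of at most one lands on
  \<open>h\<close>.\<close>

lemma obs_intermediate:
  fixes V :: "nat set"
  assumes "finite V" "finite F" "enat h \<le> obs (complete_minus V F)"
  shows "\<exists>F'. obs (complete_minus V F') = enat h"
  using assms(2,3)
proof (induction F rule: finite_induct)
  case empty
  then have "enat h = 0" by (simp add: obs_complete zero_enat_def)
  then show ?case using obs_complete by metis
next
  case (insert e F)
  show ?case
  proof (cases "enat h \<le> obs (complete_minus V F)")
    case False
    then have "obs (complete_minus V F) + 1 \<le> enat h"
      by (simp add: not_le ileI1 plus_1_eSuc)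
    then have "obs (complete_minus V (insert e F)) = enat h"
      using insert.prems obs_delete_edge[OF assms(1), of e F] by simp
    then show ?thesis by blast
  qed (use insert.IH in blast)
qed

theorem theorem3:
  shows "\<forall>h::nat. \<exists>G :: nat pair_pre_digraph. pair_graph G \<and> obs G = enat h"
proof
  fix h :: nat
  let ?L = "lex_verts (2 * h)"
  \<comment> \<open>Words are coded injectively as natural numbers to obtain the required vertex
    type.\<close>
  define V where "V = to_nat ` ?L"
  \<comment> \<open>As no word is adjacent to itself, \<open>F\<close> also contains singletons;
    these delete no arc.\<close>
  define F where "F = {{to_nat x, to_nat y} | x y. x \<in> ?L \<and> y \<in> ?L \<and> \<not> lex_adj x y}"
  have "finite V" by (simp add: V_def finite_lex_verts)
  have "finite F"
    by (rule finite_subset[of _ "(\<lambda>(x, y). {to_nat x, to_nat y}) ` (?L \<times> ?L)"])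
      (auto simp: F_def finite_lex_verts)
  have "enat h \<le> obs (complete_minus V F)"
    unfolding obs_def
  proof (rule INF_greatest)
    fix \<O> assume "\<O> \<in> {\<O>. \<exists>p. obstacle_representation (complete_minus V F) p \<O>}"
    then obtain p where rep: "obstacle_representation (complete_minus V F) p \<O>" by blast
    have "(to_nat x, to_nat y) \<in> parcs (complete_minus V F) \<longleftrightarrow> lex_adj x y"
      if "x \<in> ?L" "y \<in> ?L" "x \<noteq> y" for x y
      using that lex_adj_sym by (auto simp: complete_minus_def V_def F_def doubleton_eq_iff)
    then have "h \<le> card \<O>"
      by (intro card_obstacles_ge[OF rep, of to_nat]) (auto simp: complete_minus_def V_def inj_on_def)
    then show "enat h \<le> enat (card \<O>)" by simp
  qed
  from obs_intermediate[OF \<open>finite V\<close> \<open>finite F\<close> this]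
  show "\<exists>G :: nat pair_pre_digraph. pair_graph G \<and> obs G = enat h"
    using pair_graph_complete_minus[OF \<open>finite V\<close>] by blast
qed

end
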